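(* Let $\mathcal{C}$ be a small addable class of graphs and let $\phi$ be a sentence of monadic second-order logic (MSO) in the language of graphs. Let $p_n$ denote the probability that $R_n(\mathcal{C} \cap \mathrm{Conn})$ satisfies $\phi$, where $\mathrm{Conn}$ is the class of connected graphs. Then $\lim_{n\to\infty} p_n$ exists and is equal to either $0$ or $1$.
   Context: Graphs are finite, simple and undirected; a class of graphs is closed under isomorphism. For a class $\mathcal{C}$, $\mathcal{C}_n$ is the set of graphs in $\mathcal{C}$ with vertex set $[n]=\{1,\ldots,n\}$, and $R_n(\mathcal{C})$ is a random graph drawn from the uniform distribution on $\mathcal{C}_n$. $\mathcal{C}$ is decomposable if a graph $G$ is in $\mathcal{C}$ if and only if every connected component of $G$ is in $\mathcal{C}$. $\mathcal{C}$ is bridge-addable if for every $G\in\mathcal{C}$ and vertices $u,v$ in distinct connected components of $G$, the graph obtained by adding the edge $\{u,v\}$ is in $\mathcal{C}$. $\mathcal{C}$ is addable if it is decomposable and bridge-addable. $\mathcal{C}$ is small if $|\mathcal{C}_n| \le d^n n!$ for all $n$, for some real $d$. MSO formulas are built from atomic formulas $x\in X$ and $E(x,y)$ (first-order variables $x,y$ ranging over vertices, second-order variables $X$ ranging over sets of vertices) using $\wedge,\vee,\neg$ and first- and second-order quantifiers. *)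

theory Defs
  imports "HOL-Probability.Probability_Mass_Function" "Graph_Theory.Graph_Theory"
begin

text \<open>A finite simple undirected graph is a \<^locale>\<open>pair_graph\<close>: a finite loopfree digraph
  without parallel arcs whose arc relation is symmetric, so that the edge between \<open>u\<close> and \<open>v\<close>
  is the pair of arcs \<open>(u, v)\<close>, \<open>(v, u)\<close>.  Vertices are natural numbers; up to isomorphism this
  is no restriction.  The empty graph is a graph, but it is not connected.\<close>

type_synonym ngraph = "nat pair_pre_digraph"

definition graph_class :: "ngraph set \<Rightarrow> bool" where
  "graph_class C \<longleftrightarrow>
     (\<forall>G\<in>C. pair_graph G) \<and>
     (\<forall>G H. G \<in> C \<longrightarrow> pair_graph H \<longrightarrow> digraph_iso (with_proj G) (with_proj H) \<longrightarrow> H \<in> C)"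

text \<open>The name \<open>connected\<close> is qualified because of the topological notion.\<close>

definition Conn :: "ngraph set" where
  "Conn = {G. pair_graph G \<and> Digraph_Component.connected (with_proj G)}"

definition components :: "ngraph \<Rightarrow> ngraph set" where
  "components G =
     {H. pre_digraph.max_subgraph (with_proj G) Digraph_Component.connected (with_proj H)}"

definition add_edge :: "ngraph \<Rightarrow> nat \<Rightarrow> nat \<Rightarrow> ngraph" where
  "add_edge G u v = \<lparr>pverts = pverts G, parcs = parcs G \<union> {(u, v), (v, u)}\<rparr>"

definition decomposable :: "ngraph set \<Rightarrow> bool" where
  "decomposable C \<longleftrightarrow> (\<forall>G. pair_graph G \<longrightarrow> (G \<in> C \<longleftrightarrow> components G \<subseteq> C))"

definition bridge_addable :: "ngraph set \<Rightarrow> bool" where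
  "bridge_addable C \<longleftrightarrow>
     (\<forall>G\<in>C. \<forall>H\<^sub>1\<in>components G. \<forall>H\<^sub>2\<in>components G. H\<^sub>1 \<noteq> H\<^sub>2 \<longrightarrow>
        (\<forall>u\<in>pverts H\<^sub>1. \<forall>v\<in>pverts H\<^sub>2. add_edge G u v \<in> C))"

definition addable :: "ngraph set \<Rightarrow> bool" where
  "addable C \<longleftrightarrow> decomposable C \<and> bridge_addable C"

definition labelled :: "ngraph set \<Rightarrow> nat \<Rightarrow> ngraph set" where
  "labelled C n = {G \<in> C. pverts G = {1..n}}"

definition small :: "ngraph set \<Rightarrow> bool" where
  "small C \<longleftrightarrow> (\<exists>d::real. \<forall>n. real (card (labelled C n)) \<le> d ^ n * fact n)"

text \<open>Only meaningful if \<open>labelled C n\<close> is nonempty; it is always finite, see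
  \<open>finite_labelled\<close>.\<close>

definition random_graph :: "ngraph set \<Rightarrow> nat \<Rightarrow> ngraph pmf" where
  "random_graph C n = pmf_of_set (labelled C n)"

text \<open>An addable class may have no member on \<open>n\<close> vertices for infinitely many \<open>n\<close> (an example is
  the class of forests all of whose components have a perfect matching), and then the random
  graph does not exist for these \<open>n\<close>.  Limits as \<open>n\<close> tends to infinity are taken
  along those \<open>n\<close> for which it exists.  If it exists for all large \<open>n\<close>, this filter is
  \<^const>\<open>sequentially\<close>.\<close>

definition sizes_at_top :: "ngraph set \<Rightarrow> nat filter" where
  "sizes_at_top C = inf sequentially (principal {n. labelled C n \<noteq> {}})"

text \<open>Monadic second-order formulas.  First-order and second-order variables are two separate
  families, each indexed by natural numbers: \<open>In x X\<close> is the atom stating that the vertex \<open>x\<close> is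
  in the set \<open>X\<close>; \<open>Ex1\<close>, \<open>All1\<close> bind vertex variables and \<open>Ex2\<close>, \<open>All2\<close> bind set
  variables.\<close>

datatype mso =
    In nat nat
  | Edge nat nat
  | Neg mso
  | Conj mso mso
  | Disj mso mso
  | Ex1 nat mso
  | All1 nat mso
  | Ex2 nat mso
  | All2 nat mso

primrec free1 :: "mso \<Rightarrow> nat set" where
  "free1 (In x X) = {x}"
| "free1 (Edge x y) = {x, y}"
| "free1 (Neg \<phi>) = free1 \<phi>"
| "free1 (Conj \<phi> \<psi>) = free1 \<phi> \<union> free1 \<psi>"
| "free1 (Disj \<phi> \<psi>) = free1 \<phi> \<union> free1 \<psi>"
| "free1 (Ex1 x \<phi>) = free1 \<phi> - {x}"
| "free1 (All1 x \<phi>) = free1 \<phi> - {x}"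
| "free1 (Ex2 X \<phi>) = free1 \<phi>"
| "free1 (All2 X \<phi>) = free1 \<phi>"

primrec free2 :: "mso \<Rightarrow> nat set" where
  "free2 (In x X) = {X}"
| "free2 (Edge x y) = {}"
| "free2 (Neg \<phi>) = free2 \<phi>"
| "free2 (Conj \<phi> \<psi>) = free2 \<phi> \<union> free2 \<psi>"
| "free2 (Disj \<phi> \<psi>) = free2 \<phi> \<union> free2 \<psi>"
| "free2 (Ex1 x \<phi>) = free2 \<phi>"
| "free2 (All1 x \<phi>) = free2 \<phi>"
| "free2 (Ex2 X \<phi>) = free2 \<phi> - {X}"
| "free2 (All2 X \<phi>) = free2 \<phi> - {X}"

definition mso_sentence :: "mso \<Rightarrow> bool" where
  "mso_sentence \<phi> \<longleftrightarrow> free1 \<phi> = {} \<and> free2 \<phi> = {}"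

primrec sat :: "ngraph \<Rightarrow> (nat \<Rightarrow> nat) \<Rightarrow> (nat \<Rightarrow> nat set) \<Rightarrow> mso \<Rightarrow> bool" where
  "sat G a A (In x X) \<longleftrightarrow> a x \<in> A X"
| "sat G a A (Edge x y) \<longleftrightarrow> (a x, a y) \<in> parcs G"
| "sat G a A (Neg \<phi>) \<longleftrightarrow> \<not> sat G a A \<phi>"
| "sat G a A (Conj \<phi> \<psi>) \<longleftrightarrow> sat G a A \<phi> \<and> sat G a A \<psi>"
| "sat G a A (Disj \<phi> \<psi>) \<longleftrightarrow> sat G a A \<phi> \<or> sat G a A \<psi>"
| "sat G a A (Ex1 x \<phi>) \<longleftrightarrow> (\<exists>v\<in>pverts G. sat G (a(x := v)) A \<phi>)"
| "sat G a A (All1 x \<phi>) \<longleftrightarrow> (\<forall>v\<in>pverts G. sat G (a(x := v)) A \<phi>)"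
| "sat G a A (Ex2 X \<phi>) \<longleftrightarrow> (\<exists>S\<subseteq>pverts G. sat G a (A(X := S)) \<phi>)"
| "sat G a A (All2 X \<phi>) \<longleftrightarrow> (\<forall>S\<subseteq>pverts G. sat G a (A(X := S)) \<phi>)"

text \<open>Intended for sentences, whose truth value does not depend on the initial assignment
  (\<open>models_iff_sat\<close> below); the one chosen here is arbitrary.\<close>

definition models :: "ngraph \<Rightarrow> mso \<Rightarrow> bool" where
  "models G \<phi> \<longleftrightarrow> sat G (\<lambda>_. 0) (\<lambda>_. {}) \<phi>"

lemma sat_cong:
  assumes "\<And>x. x \<in> free1 \<phi> \<Longrightarrow> a x = b x" and "\<And>X. X \<in> free2 \<phi> \<Longrightarrow> A X = B X"
  shows "sat G a A \<phi> \<longleftrightarrow> sat G b B \<phi>"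
  using assms
proof (induction \<phi> arbitrary: a b A B)
  case (Neg \<phi>)
  then show ?case by (metis free1.simps(3) free2.simps(3) sat.simps(3))
next
  case (Conj \<phi> \<psi>)
  have "sat G a A \<phi> \<longleftrightarrow> sat G b B \<phi>" "sat G a A \<psi> \<longleftrightarrow> sat G b B \<psi>"
    by (rule Conj.IH; simp add: Conj.prems)+
  then show ?case by simp
next
  case (Disj \<phi> \<psi>)
  have "sat G a A \<phi> \<longleftrightarrow> sat G b B \<phi>" "sat G a A \<psi> \<longleftrightarrow> sat G b B \<psi>"
    by (rule Disj.IH; simp add: Disj.prems)+
  then show ?case by simp
next
  case (Ex1 x \<phi>)
  have "sat G (a(x := v)) A \<phi> \<longleftrightarrow> sat G (b(x := v)) B \<phi>" for v
    by (rule Ex1.IH) (use Ex1.prems in auto)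
  then show ?case by simp
next
  case (All1 x \<phi>)
  have "sat G (a(x := v)) A \<phi> \<longleftrightarrow> sat G (b(x := v)) B \<phi>" for v
    by (rule All1.IH) (use All1.prems in auto)
  then show ?case by simp
next
  case (Ex2 X \<phi>)
  have "sat G a (A(X := S)) \<phi> \<longleftrightarrow> sat G b (B(X := S)) \<phi>" for S
    by (rule Ex2.IH) (use Ex2.prems in auto)
  then show ?case by simp
next
  case (All2 X \<phi>)
  have "sat G a (A(X := S)) \<phi> \<longleftrightarrow> sat G b (B(X := S)) \<phi>" for S
    by (rule All2.IH) (use All2.prems in auto)
  then show ?case by simp
qed auto

lemma models_iff_sat: "mso_sentence \<phi> \<Longrightarrow> models G \<phi> \<longleftrightarrow> sat G a A \<phi>"
  unfolding models_def mso_sentence_def by (rule sat_cong) auto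

lemma finite_labelled:
  assumes "graph_class C"
  shows "finite (labelled C n)"
proof (rule finite_subset)
  let ?V = "{1..n}"
  show "labelled C n \<subseteq> (\<lambda>E. \<lparr>pverts = ?V, parcs = E\<rparr>) ` Pow (?V \<times> ?V)"
  proof
    fix G assume G: "G \<in> labelled C n"
    then interpret pair_graph G
      using assms by (auto simp: graph_class_def labelled_def)
    have "parcs G \<subseteq> ?V \<times> ?V"
      using G by (auto simp: labelled_def dest: wellformed')
    moreover have "G = \<lparr>pverts = ?V, parcs = parcs G\<rparr>"
      using G by (simp add: labelled_def)
    ultimately show "G \<in> (\<lambda>E. \<lparr>pverts = ?V, parcs = E\<rparr>) ` Pow (?V \<times> ?V)"
      by blast
  qed
qed simp

lemma sizes_at_top_eq_sequentially:
  assumes "eventually (\<lambda>n. labelled C n \<noteq> {}) sequentially"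
  shows "sizes_at_top C = sequentially"
  unfolding sizes_at_top_def using assms by (simp add: inf_absorb1 le_principal)

end

theory Submission
  imports Defs
begin

text \<open>Only the class of connected members matters; it is closed under isomorphism and under joining
  two disjoint members by a bridge, and it is small.

  \<^emph>\<open>Logic.\<close>  Up to quantifier rank \<open>q\<close> there are finitely many MSO types of rooted graphs.  The type
  of a graph with further graphs attached to its root by bridges depends only on the types
  involved, and adding one more copy to many copies of the same graph changes nothing.  A universal
  member \<open>N\<close>, with many copies of every type attached to its root, therefore absorbs every member
  attached to it.  In a long chain of copies of \<open>N\<close> this even works if what is attached is not a member,
  as long as the result is one.  Hence all members having such a chain as a pendant subgraph agree on
  the sentence.

  \<^emph>\<open>Counting.\<close>  Let \<open>c n\<close> be the number of members on \<open>{1..n}\<close> and let \<open>h\<close> be the size of the chain.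
  Attaching \<open>k\<close> pendant copies one after the other turns a member without pendant copies into one with
  at most \<open>k\<close> of them.  So \<open>b n / n!\<close>, where \<open>b n\<close> counts the members without pendant copies, is
  at most \<open>k! (h! / n) ^ k\<close> times \<open>c (n + k h) / (n + k h)!\<close>.  Because \<open>c n / (2 n!)\<close> is
  supermultiplicative, it has a growth constant, and taking for \<open>k\<close> a small fraction of \<open>n\<close> shows that \<open>b n / c n\<close>
  tends to \<open>0\<close>.\<close>

section \<open>Types of attached graphs\<close>

text \<open>Coding finite sets by numbers lets the types of all ranks live in \<open>nat\<close>,
  although a type of rank \<open>q + 1\<close> contains sets of types of rank
  \<open>q\<close>.\<close>

definition enc :: "'a::countable set \<Rightarrow> nat" where
  "enc A = set_encode (to_nat ` A)"

lemma enc_eq_iff: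
  assumes "finite A" "finite B"
  shows "enc A = enc B \<longleftrightarrow> A = B"
  using assms by (simp add: enc_def set_encode_eq inj_image_eq_iff)

type_synonym struct = "nat set \<times> nat rel \<times> nat \<times> (nat \<Rightarrow> nat set)"

text \<open>\<open>Attach s h\<close> stands for \<open>s\<close> and \<open>h\<close> put side by
  side, with an edge between their roots and the root of \<open>s\<close> as the new root. Terms
  stay formal, so one graph can be attached many times without renaming vertices.\<close>

datatype gterm = Leaf struct | Attach gterm gterm

type_synonym atoms = "(nat \<times> nat \<times> nat) set"

text \<open>Tag 0 is adjacency, tag 1 intersection, tag 2 membership of the root, tag 3 having at
  least two elements. Vertices are represented by singletons, which are recognised by tag 1 without
  tag 3.\<close>

definition leaf_atoms :: "struct \<Rightarrow> atoms" where
  "leaf_atoms = (\<lambda>(V, E, r, A).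
     {(0, X, Y) | X Y. \<exists>a\<in>A X. \<exists>b\<in>A Y. (a, b) \<in> E} \<union>
     {(1, X, Y) | X Y. A X \<inter> A Y \<noteq> {}} \<union>
     {(2, X, X) | X. r \<in> A X} \<union>
     {(3, X, X) | X. \<exists>a\<in>A X. \<exists>b\<in>A X. a \<noteq> b})"

text \<open>The atoms of a disjoint union with an edge between the roots: the new edge shows up
  through tag 2, and a set also has two elements if it meets both parts.\<close>

definition attach_atoms :: "atoms \<Rightarrow> atoms \<Rightarrow> atoms" where
  "attach_atoms s h =
     {(0, X, Y) | X Y. (0, X, Y) \<in> s \<or> (0, X, Y) \<in> h \<or>
        (2, X, X) \<in> s \<and> (2, Y, Y) \<in> h \<or> (2, X, X) \<in> h \<and> (2, Y, Y) \<in> s} \<union>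
     {(1, X, Y) | X Y. (1, X, Y) \<in> s \<or> (1, X, Y) \<in> h} \<union>
     {(2, X, X) | X. (2, X, X) \<in> s} \<union>
     {(3, X, X) | X. (3, X, X) \<in> s \<or> (3, X, X) \<in> h \<or> (1, X, X) \<in> s \<and> (1, X, X) \<in> h}"

primrec all_atoms :: "gterm \<Rightarrow> atoms" where
  "all_atoms (Leaf s) = leaf_atoms s"
| "all_atoms (Attach s h) = attach_atoms (all_atoms s) (all_atoms h)"

text \<open>These are the moves of the game: the set \<open>X\<close> is chosen anew. In an
  attachment, a set is a free choice of a set in each part.\<close>

primrec succs :: "nat \<Rightarrow> gterm \<Rightarrow> gterm set" where
  "succs X (Leaf s) = (case s of (V, E, r, A) \<Rightarrow> {Leaf (V, E, r, A(X := S)) | S. S \<subseteq> V})"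
| "succs X (Attach s h) = {Attach s' h' | s' h'. s' \<in> succs X s \<and> h' \<in> succs X h}"

text \<open>Only set variables below \<open>k\<close> are seen, which keeps the number of types
  finite.\<close>

definition atoms_upto :: "nat \<Rightarrow> gterm \<Rightarrow> atoms" where
  "atoms_upto k s = all_atoms s \<inter> {..3} \<times> {..<k} \<times> {..<k}"

lemma finite_atoms_upto [simp]: "finite (atoms_upto k s)"
  by (simp add: atoms_upto_def)

lemma atoms_upto_Attach:
  "atoms_upto k (Attach s h) = attach_atoms (atoms_upto k s) (atoms_upto k h)"
  unfolding atoms_upto_def by (auto simp: attach_atoms_def)

text \<open>Equal types mean that the duplicator wins the \<open>q\<close>-round game on the first
  \<open>k\<close> set variables. The atoms are recorded at every rank, so equal types always have
  equal atoms.\<close>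

primrec ty :: "nat \<Rightarrow> nat \<Rightarrow> gterm \<Rightarrow> nat" where
  "ty k 0 s = enc (atoms_upto k s)"
| "ty k (Suc q) s = prod_encode (enc (atoms_upto k s), enc (SIGMA X:{..<k}. ty k q ` succs X s))"

lemma finite_range_ty: "finite (range (ty k q))"
proof (induction q)
  case 0
  have "range (ty k 0) \<subseteq> enc ` Pow ({..3::nat} \<times> {..<k} \<times> {..<k})"
    by (auto simp: atoms_upto_def)
  then show ?case by (rule finite_subset) simp
next
  case (Suc q)
  have "range (ty k (Suc q)) \<subseteq>
    prod_encode ` (enc ` Pow ({..3::nat} \<times> {..<k} \<times> {..<k}) \<times> enc ` Pow ({..<k} \<times> range (ty k q)))"
    by (auto simp: atoms_upto_def intro!: imageI)
  then show ?case by (rule finite_subset) (simp add: Suc)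
qed

lemma finite_ty_image [simp]: "finite (ty k q ` S)"
  by (rule finite_subset[OF _ finite_range_ty]) auto

lemma ty_0_eq_iff: "ty k 0 s = ty k 0 s' \<longleftrightarrow> atoms_upto k s = atoms_upto k s'"
  by (simp add: enc_eq_iff)

lemma Sigma_eq_iff: "Sigma I F = Sigma I G \<longleftrightarrow> (\<forall>X\<in>I. F X = G X)"
  by blast

lemma ty_Suc_eq_iff:
  "ty k (Suc q) s = ty k (Suc q) s' \<longleftrightarrow> atoms_upto k s = atoms_upto k s' \<and>
     (\<forall>X<k. ty k q ` succs X s = ty k q ` succs X s')"
proof -
  have "finite (SIGMA X:{..<k}. ty k q ` succs X s)" for s
    by (intro finite_SigmaI finite_ty_image finite_lessThan)
  then show ?thesis
    by (simp add: enc_eq_iff Sigma_eq_iff Ball_def)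
qed

declare ty.simps [simp del]

lemma ty_eq_imp_atoms: "ty k q s = ty k q s' \<Longrightarrow> atoms_upto k s = atoms_upto k s'"
  by (cases q) (auto simp: ty_0_eq_iff ty_Suc_eq_iff)

lemma ty_Suc_eqI:
  assumes "atoms_upto k s = atoms_upto k s'"
    and "\<And>X s1. X < k \<Longrightarrow> s1 \<in> succs X s \<Longrightarrow> \<exists>s1'\<in>succs X s'. ty k q s1 = ty k q s1'"
    and "\<And>X s1'. X < k \<Longrightarrow> s1' \<in> succs X s' \<Longrightarrow> \<exists>s1\<in>succs X s. ty k q s1 = ty k q s1'"
  shows "ty k (Suc q) s = ty k (Suc q) s'"
  unfolding ty_Suc_eq_iff
proof (intro conjI allI impI equalityI subsetI)
  fix X \<tau> assume "X < k" "\<tau> \<in> ty k q ` succs X s"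
  then obtain s1 where "s1 \<in> succs X s" "\<tau> = ty k q s1" by (elim imageE)
  with \<open>X < k\<close> obtain s1' where "s1' \<in> succs X s'" "\<tau> = ty k q s1'"
    using assms(2) by blast
  then show "\<tau> \<in> ty k q ` succs X s'" by (rule rev_image_eqI)
next
  fix X \<tau> assume "X < k" "\<tau> \<in> ty k q ` succs X s'"
  then obtain s1' where "s1' \<in> succs X s'" "\<tau> = ty k q s1'" by (elim imageE)
  with \<open>X < k\<close> obtain s1 where "s1 \<in> succs X s" "\<tau> = ty k q s1"
    using assms(3) by metis
  then show "\<tau> \<in> ty k q ` succs X s" by (rule rev_image_eqI)
qed (use assms(1) in auto)

lemma ty_Suc_eqD:
  assumes "ty k (Suc q) s = ty k (Suc q) s'" "X < k" "s1 \<in> succs X s"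
  obtains s1' where "s1' \<in> succs X s'" "ty k q s1 = ty k q s1'"
  using assms unfolding ty_Suc_eq_iff by (metis imageE imageI)

text \<open>A back-and-forth relation wins the game of every length, so it can be given without
  counting rounds.\<close>

lemma ty_eq_if_bisim:
  assumes R: "R s s'"
    and atoms: "\<And>s s'. R s s' \<Longrightarrow> atoms_upto k s = atoms_upto k s'"
    and zig: "\<And>s s' X s1. R s s' \<Longrightarrow> s1 \<in> succs X s \<Longrightarrow> \<exists>s1'\<in>succs X s'. R s1 s1'"
    and zag: "\<And>s s' X s1'. R s s' \<Longrightarrow> s1' \<in> succs X s' \<Longrightarrow> \<exists>s1\<in>succs X s. R s1 s1'"
  shows "ty k q s = ty k q s'"
  using R
proof (induction q arbitrary: s s')
  case 0
  then show ?case by (simp add: ty_0_eq_iff atoms)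
next
  case (Suc q)
  show ?case
    by (rule ty_Suc_eqI) (use Suc atoms zig zag in blast)+
qed

section \<open>Composition of types\<close>

text \<open>The duplicator plays two games side by side, since a move in an attachment is a pair of
  moves.\<close>

lemma ty_Attach_cong:
  assumes "ty k q s = ty k q s'" "ty k q h = ty k q h'"
  shows "ty k q (Attach s h) = ty k q (Attach s' h')"
  using assms
proof (induction q arbitrary: s h s' h')
  case 0
  then show ?case by (simp add: ty_0_eq_iff atoms_upto_Attach)
next
  case (Suc q)
  have *: "\<exists>t'\<in>succs X (Attach s' h'). ty k q t = ty k q t'"
    if "X < k" "t \<in> succs X (Attach s h)" "ty k (Suc q) s = ty k (Suc q) s'"
      "ty k (Suc q) h = ty k (Suc q) h'" for X t s h s' h'
  proof -
    from that obtain s1 h1 where t: "t = Attach s1 h1" "s1 \<in> succs X s" "h1 \<in> succs X h"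
      by auto
    from that t obtain s1' where 1: "s1' \<in> succs X s'" "ty k q s1 = ty k q s1'"
      using ty_Suc_eqD by metis
    from that t obtain h1' where 2: "h1' \<in> succs X h'" "ty k q h1 = ty k q h1'"
      using ty_Suc_eqD by metis
    from 1 2 Suc.IH[of s1 s1' h1 h1'] t show ?thesis
      by auto
  qed
  show ?case
  proof (rule ty_Suc_eqI)
    show "atoms_upto k (Attach s h) = atoms_upto k (Attach s' h')"
      using Suc.prems[THEN ty_eq_imp_atoms] by (simp add: atoms_upto_Attach)
  qed (use * Suc.prems in \<open>metis\<close>)+
qed

lemma attach_atoms_swap:
  "attach_atoms (attach_atoms s h) h' = attach_atoms (attach_atoms s h') h"
  unfolding attach_atoms_def by auto

text \<open>Both graphs hang at the root of \<open>s\<close>, so their order is immaterial.\<close>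

lemma ty_Attach_swap:
  "ty k q (Attach (Attach s h) h') = ty k q (Attach (Attach s h') h)"
proof (rule ty_eq_if_bisim[where R = "\<lambda>t t'. \<exists>s h h'. t = Attach (Attach s h) h' \<and> t' = Attach (Attach s h') h"],
    goal_cases)
  case (2 t t')
  then show ?case by (auto simp: atoms_upto_Attach attach_atoms_swap)
qed (fastforce+)

primrec glue :: "gterm \<Rightarrow> gterm list \<Rightarrow> gterm" where
  "glue s [] = s"
| "glue s (h # hs) = Attach (glue s hs) h"

text \<open>By congruence, attaching acts on types, and by the swap these actions commute. The type
  of a gluing is therefore a fold over a multiset of types.\<close>

lemma ty_glue_cong:
  assumes "ty k q s = ty k q s'" "mset (map (ty k q) hs) = mset (map (ty k q) hs')"
  shows "ty k q (glue s hs) = ty k q (glue s' hs')"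
proof -
  \<comment> \<open>\<open>rep\<close> picks a term of the given type; \<open>F \<tau>\<close> is
    the effect on types of attaching a graph of type \<open>\<tau>\<close>.\<close>
  define rep where "rep \<tau> = inv (ty k q) \<tau>" for \<tau>
  define F where "F \<tau> \<sigma> = ty k q (Attach (rep \<sigma>) (rep \<tau>))" for \<tau> \<sigma>
  have rep: "ty k q (rep (ty k q t)) = ty k q t" for t
    unfolding rep_def by (simp add: f_inv_into_f)
  have F: "F (ty k q h) (ty k q t) = ty k q (Attach t h)" for h t
    unfolding F_def by (rule ty_Attach_cong) (simp_all add: rep)
  interpret comp_fun_commute F
  proof
    have "F \<tau> (F \<tau>' \<sigma>) = F \<tau>' (F \<tau> \<sigma>)" for \<tau> \<tau>' \<sigma>
    proof -
      have "F \<tau> (F \<tau>' \<sigma>) = ty k q (Attach (Attach (rep \<sigma>) (rep \<tau>')) (rep \<tau>))" for \<tau> \<tau>'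
        unfolding F_def by (rule ty_Attach_cong) (simp_all add: rep)
      then show ?thesis by (simp add: ty_Attach_swap)
    qed
    then show "F \<tau>' \<circ> F \<tau> = F \<tau> \<circ> F \<tau>'" for \<tau> \<tau>' by (simp add: fun_eq_iff)
  qed
  have "ty k q (glue s hs) = fold_mset F (ty k q s) (mset (map (ty k q) hs))" for s hs
    by (induction hs) (simp_all flip: F)
  then show ?thesis using assms by simp
qed

lemma succs_glue:
  "succs X (glue s hs) = {glue s' hs' | s' hs'. s' \<in> succs X s \<and> list_all2 (\<lambda>h h'. h' \<in> succs X h) hs hs'}"
proof (induction hs)
  case (Cons h hs)
  show ?case (is "?L = ?R")
  proof (intro equalityI subsetI)
    fix t assume "t \<in> ?L"
    then obtain s' hs' h' where "t = glue s' (h' # hs')" "s' \<in> succs X s" "h' \<in> succs X h"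
        "list_all2 (\<lambda>h h'. h' \<in> succs X h) hs hs'"
      by (auto simp: Cons.IH)
    then show "t \<in> ?R" by blast
  next
    fix t assume "t \<in> ?R"
    then show "t \<in> ?L" by (fastforce simp: Cons.IH list_all2_Cons1)
  qed
qed simp

section \<open>Aperiodicity of types\<close>

text \<open>The recursion is made for the pigeonhole principle: with more copies than
  \<open>thr k q\<close> times the number of types of rank \<open>q\<close>, every move leaves more
  than \<open>thr k q\<close> of them with a common type. The summand 2 makes this bound strict and
  provides the two copies that the atoms require.\<close>

primrec thr :: "nat \<Rightarrow> nat \<Rightarrow> nat" where
  "thr k 0 = 2"
| "thr k (Suc q) = card (range (ty k q)) * thr k q + 2"

lemma pigeonhole_fibre:
  assumes "finite I" "f ` I \<subseteq> T" "finite T" "card T * m < card I"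
  obtains y where "y \<in> T" "m < card {i \<in> I. f i = y}"
proof -
  have "\<exists>y\<in>T. m < card {i \<in> I. f i = y}"
  proof (rule ccontr)
    assume "\<not> ?thesis"
    then have le: "\<And>y. y \<in> T \<Longrightarrow> card {i \<in> I. f i = y} \<le> m" by (auto simp: not_less)
    have "I = (\<Union>y\<in>T. {i \<in> I. f i = y})" using assms by auto
    then have "card I \<le> (\<Sum>y\<in>T. card {i \<in> I. f i = y})"
      using card_UN_le[OF assms(3), of "\<lambda>y. {i \<in> I. f i = y}"] by simp
    also have "\<dots> \<le> (\<Sum>y\<in>T. m)" by (rule sum_mono) (use le in auto)
    finally show False using assms by simp
  qed
  then show ?thesis using that by auto
qed

text \<open>One copy would not be enough: a set that has one element in each copy may gain tag 3
  only with the second.\<close>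

lemma attach_atoms_third_copy:
  "attach_atoms (attach_atoms (attach_atoms s h) h) h = attach_atoms (attach_atoms s h) h"
  unfolding attach_atoms_def by auto

lemma ty_0_glue_extra_copy:
  assumes "2 \<le> card {i. i < length hs \<and> ty k 0 (hs ! i) = ty k 0 j}"
  shows "ty k 0 (glue s (j # hs)) = ty k 0 (glue s hs)"
proof -
  let ?I = "{i. i < length hs \<and> ty k 0 (hs ! i) = ty k 0 j}"
  have "2 \<le> card ?I" using assms by simp
  then have "\<not> card ?I \<le> Suc 0" by simp
  then have "\<not> (\<forall>i\<in>?I. \<forall>i'\<in>?I. i = i')" by (subst (asm) card_le_Suc0_iff_eq) auto
  then obtain a b where "a \<in> ?I" "b \<in> ?I" "a \<noteq> b" by blast
  then obtain i i' where "i \<in> ?I" "i' \<in> ?I" "i < i'" by (cases "a < b") auto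
  then have ii: "i < length hs" "i' < length hs" "i < i'"
      "ty k 0 (hs ! i) = ty k 0 j" "ty k 0 (hs ! i') = ty k 0 j"
    by simp_all
  \<comment> \<open>\<open>gs\<close> is \<open>hs\<close> without the entries \<open>i\<close> and
    \<open>i'\<close>; up to types, \<open>hs\<close> is then \<open>gs\<close> with two copies of
    \<open>j\<close> in front.\<close>
  define gs where "gs = take i hs @ drop (Suc i) (take i' hs) @ drop (Suc i') hs"
  have "hs = take i' hs @ hs ! i' # drop (Suc i') hs"
    using ii by (simp add: id_take_nth_drop)
  moreover have "take i' hs = take i hs @ hs ! i # drop (Suc i) (take i' hs)"
    using ii id_take_nth_drop[of i "take i' hs"] by simp
  ultimately have "mset hs = mset (hs ! i # hs ! i' # gs)"
    unfolding gs_def by (metis (no_types, lifting) append.assoc append_Cons mset.simps(2) mset_append union_mset_add_mset_left union_mset_add_mset_right)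
  then have ms: "mset (map (ty k 0) hs) = mset (map (ty k 0) (j # j # gs))"
    using ii by (metis (no_types, lifting) list.simps(9) mset_map)
  have "ty k 0 (glue s (j # hs)) = ty k 0 (glue s (j # j # j # gs))"
    by (rule ty_glue_cong) (use ms in auto)
  also have "\<dots> = ty k 0 (glue s (j # j # gs))"
    by (simp add: ty_0_eq_iff atoms_upto_Attach attach_atoms_third_copy)
  also have "\<dots> = ty k 0 (glue s hs)"
    by (rule ty_glue_cong) (use ms in auto)
  finally show ?thesis .
qed

text \<open>Aperiodicity is what distinguishes MSO from its extension by modular counting: the type
  of a graph does not change if one more copy is attached to sufficiently many.\<close>

lemma ty_glue_extra_copy:
  assumes "thr k q \<le> card {i. i < length hs \<and> ty k q (hs ! i) = ty k q j}"
  shows "ty k q (glue s (j # hs)) = ty k q (glue s hs)"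
  using assms
proof (induction q arbitrary: s hs j)
  case 0
  then show ?case using ty_0_glue_extra_copy by simp
next
  case (Suc q)
  let ?I = "{i. i < length hs \<and> ty k (Suc q) (hs ! i) = ty k (Suc q) j}"
  \<comment> \<open>Pigeonhole on the copies of \<open>j\<close>: after any move in the list, some
    position in \<open>?I\<close> carries a type that occurs more than \<open>thr k q\<close>
    times.\<close>
  have frequent: "\<exists>i\<in>?I. thr k q < card {i'. i' < length hs1 \<and> ty k q (hs1 ! i') = ty k q (hs1 ! i)}"
    if len: "length hs1 = length hs" for hs1
  proof -
    obtain y where y: "thr k q < card {i \<in> ?I. ty k q (hs1 ! i) = y}"
      by (rule pigeonhole_fibre[of ?I "\<lambda>i. ty k q (hs1 ! i)" "range (ty k q)" "thr k q"])
        (use Suc.prems finite_range_ty in auto)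
    then have "{i \<in> ?I. ty k q (hs1 ! i) = y} \<noteq> {}" by (metis card.empty not_less_zero)
    then obtain i where i: "i \<in> ?I" "ty k q (hs1 ! i) = y" by auto
    have "card {i \<in> ?I. ty k q (hs1 ! i) = y} \<le> card {i'. i' < length hs1 \<and> ty k q (hs1 ! i') = y}"
      by (rule card_mono) (auto simp: len)
    with y i show ?thesis by (intro bexI[of _ i]) auto
  qed
  show ?case
  proof (rule ty_Suc_eqI)
    have "thr k 0 \<le> card ?I" using Suc.prems by simp
    also have "card ?I \<le> card {i. i < length hs \<and> ty k 0 (hs ! i) = ty k 0 j}"
      by (rule card_mono) (auto dest: ty_eq_imp_atoms simp: ty_0_eq_iff)
    finally have "thr k 0 \<le> card {i. i < length hs \<and> ty k 0 (hs ! i) = ty k 0 j}" .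
    then show "atoms_upto k (glue s (j # hs)) = atoms_upto k (glue s hs)"
      using ty_0_glue_extra_copy[of hs k j s] by (simp add: ty_0_eq_iff)
  next
    fix X t assume X: "X < k" and "t \<in> succs X (glue s (j # hs))"
    then obtain s1 j1 hs1 where t: "t = glue s1 (j1 # hs1)" "s1 \<in> succs X s" "j1 \<in> succs X j"
        and hs1: "list_all2 (\<lambda>h h'. h' \<in> succs X h) hs hs1"
      unfolding succs_glue by (auto simp: list_all2_Cons1)
    have len: "length hs1 = length hs" using hs1 by (simp add: list_all2_lengthD)
    obtain i where i: "i < length hs" "ty k (Suc q) (hs ! i) = ty k (Suc q) j"
      and big: "thr k q < card {i'. i' < length hs1 \<and> ty k q (hs1 ! i') = ty k q (hs1 ! i)}"
      using frequent[OF len] by auto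
    \<comment> \<open>The move in the extra copy led to \<open>j1\<close>. Position \<open>i\<close>
      imitates it by \<open>u\<close>; what is then left over is \<open>hs1 ! i\<close>, whose type
      is still frequent without position \<open>i\<close>, so the induction hypothesis drops
      it.\<close>
    obtain u where u: "u \<in> succs X (hs ! i)" "ty k q j1 = ty k q u"
      using ty_Suc_eqD[OF i(2)[symmetric] X t(3)] .
    let ?hs2 = "hs1[i := u]"
    have "ty k q (glue s1 (j1 # hs1)) = ty k q (glue s1 (hs1 ! i # ?hs2))"
    proof (rule ty_glue_cong)
      show "mset (map (ty k q) (j1 # hs1)) = mset (map (ty k q) (hs1 ! i # ?hs2))"
        using i len u by (simp add: map_update mset_update)
    qed simp
    also have "\<dots> = ty k q (glue s1 ?hs2)"
    proof (rule Suc.IH)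
      let ?J = "{i'. i' < length hs1 \<and> ty k q (hs1 ! i') = ty k q (hs1 ! i)}"
      have "thr k q \<le> card (?J - {i})" using big by (auto simp: card_Diff_singleton_if)
      also have "\<dots> \<le> card {i'. i' < length ?hs2 \<and> ty k q (?hs2 ! i') = ty k q (hs1 ! i)}"
        by (rule card_mono) auto
      finally show "thr k q \<le> \<dots>" .
    qed
    finally have "ty k q t = ty k q (glue s1 ?hs2)" using t by simp
    moreover have "glue s1 ?hs2 \<in> succs X (glue s hs)"
      unfolding succs_glue using t hs1 u i
      by (auto intro!: exI[of _ s1] exI[of _ ?hs2] simp: list_all2_conv_all_nth nth_list_update)
    ultimately show "\<exists>t'\<in>succs X (glue s hs). ty k q t = ty k q t'" by blast
  next
    fix X t assume X: "X < k" and "t \<in> succs X (glue s hs)"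
    then obtain s1 hs1 where t: "t = glue s1 hs1" "s1 \<in> succs X s"
        and hs1: "list_all2 (\<lambda>h h'. h' \<in> succs X h) hs hs1"
      unfolding succs_glue by auto
    have len: "length hs1 = length hs" using hs1 by (simp add: list_all2_lengthD)
    obtain i where i: "i < length hs" "ty k (Suc q) (hs ! i) = ty k (Suc q) j"
      and big: "thr k q < card {i'. i' < length hs1 \<and> ty k q (hs1 ! i') = ty k q (hs1 ! i)}"
      using frequent[OF len] by auto
    have "hs1 ! i \<in> succs X (hs ! i)" using hs1 i by (simp add: list_all2_conv_all_nth)
    \<comment> \<open>Here the extra copy imitates a frequent entry, and the induction hypothesis
      absorbs it.\<close>
    then obtain j1 where j1: "j1 \<in> succs X j" "ty k q (hs1 ! i) = ty k q j1"
      using ty_Suc_eqD[OF i(2) X] by metis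
    have "ty k q (glue s1 (j1 # hs1)) = ty k q (glue s1 hs1)"
      by (rule Suc.IH) (use big j1 in auto)
    moreover have "glue s1 (j1 # hs1) \<in> succs X (glue s (j # hs))"
      unfolding succs_glue using t hs1 j1
      by (auto intro!: exI[of _ s1] exI[of _ "j1 # hs1"])
    ultimately show "\<exists>t'\<in>succs X (glue s (j # hs)). ty k q t' = ty k q t" using t by metis
  qed
qed

section \<open>Graphs joined by a bridge\<close>

definition bridge :: "nat rel \<Rightarrow> nat rel \<Rightarrow> nat \<Rightarrow> nat \<Rightarrow> nat rel" where
  "bridge E E' u v = E \<union> E' \<union> {(u, v), (v, u)}"

lemma Leaf_upd_in_succs: "S \<subseteq> V \<Longrightarrow> Leaf (V, E, r, A(X := S)) \<in> succs X (Leaf (V, E, r, A))"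
  by auto

lemma Attach_in_succs: "s' \<in> succs X s \<Longrightarrow> h' \<in> succs X h \<Longrightarrow> Attach s' h' \<in> succs X (Attach s h)"
  by auto

lemma leaf_atoms_bridge:
  assumes "V \<inter> V' = {}" "E \<subseteq> V \<times> V" "E' \<subseteq> V' \<times> V'" "u \<in> V" "v \<in> V'" "\<And>X. A X \<subseteq> V \<union> V'"
  shows "leaf_atoms (V \<union> V', bridge E E' u v, u, A) =
    attach_atoms (leaf_atoms (V, E, u, \<lambda>X. A X \<inter> V)) (leaf_atoms (V', E', v, \<lambda>X. A X \<inter> V'))"
proof -
  have uv: "u \<notin> V'" "v \<notin> V" using assms by auto
  have "(\<exists>a\<in>A X. \<exists>b\<in>A Y. (a, b) \<in> bridge E E' u v) \<longleftrightarrow>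
      (\<exists>a\<in>A X \<inter> V. \<exists>b\<in>A Y \<inter> V. (a, b) \<in> E) \<or> (\<exists>a\<in>A X \<inter> V'. \<exists>b\<in>A Y \<inter> V'. (a, b) \<in> E') \<or>
      u \<in> A X \<inter> V \<and> v \<in> A Y \<inter> V' \<or> v \<in> A X \<inter> V' \<and> u \<in> A Y \<inter> V" for X Y
    using assms uv unfolding bridge_def by blast
  moreover have "A X \<inter> A Y \<noteq> {} \<longleftrightarrow> A X \<inter> V \<inter> (A Y \<inter> V) \<noteq> {} \<or> A X \<inter> V' \<inter> (A Y \<inter> V') \<noteq> {}" for X Y
    using assms(6)[of X] by blast
  moreover have "u \<in> A X \<inter> V \<longleftrightarrow> u \<in> A X" for X using assms by auto
  moreover have "(\<exists>a\<in>A X. \<exists>b\<in>A X. a \<noteq> b) \<longleftrightarrow>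
      (\<exists>a\<in>A X \<inter> V. \<exists>b\<in>A X \<inter> V. a \<noteq> b) \<or> (\<exists>a\<in>A X \<inter> V'. \<exists>b\<in>A X \<inter> V'. a \<noteq> b) \<or>
      A X \<inter> V \<inter> (A X \<inter> V) \<noteq> {} \<and> A X \<inter> V' \<inter> (A X \<inter> V') \<noteq> {}" for X
  proof -
    have *: "(\<exists>a\<in>P \<union> Q. \<exists>b\<in>P \<union> Q. a \<noteq> b) \<longleftrightarrow>
        (\<exists>a\<in>P. \<exists>b\<in>P. a \<noteq> b) \<or> (\<exists>a\<in>Q. \<exists>b\<in>Q. a \<noteq> b) \<or> P \<inter> P \<noteq> {} \<and> Q \<inter> Q \<noteq> {}"
      if "P \<inter> Q = {}" for P Q :: "nat set"
    proof (cases "P = {} \<or> Q = {}")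
      case False
      then obtain a b where "a \<in> P" "b \<in> Q" by auto
      moreover have "a \<noteq> b" using calculation that by auto
      ultimately show ?thesis by auto
    qed auto
    have AX: "(A X \<inter> V) \<union> (A X \<inter> V') = A X" and disj: "(A X \<inter> V) \<inter> (A X \<inter> V') = {}"
      using assms(1) assms(6)[of X] by blast+
    show ?thesis using *[OF disj] by (simp only: AX)
  qed
  ultimately show ?thesis
    unfolding leaf_atoms_def attach_atoms_def by (simp del: Int_iff)
qed

text \<open>This turns formal attachment into an actual bridge. The game relation splits each set
  into its traces on \<open>V\<close> and \<open>V'\<close>; as these are disjoint, sets correspond
  to pairs of traces.\<close>

lemma ty_bridge:
  assumes "V \<inter> V' = {}" "E \<subseteq> V \<times> V" "E' \<subseteq> V' \<times> V'" "u \<in> V" "v \<in> V'"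
  shows "ty k q (Leaf (V \<union> V', bridge E E' u v, u, \<lambda>_. {})) =
    ty k q (Attach (Leaf (V, E, u, \<lambda>_. {})) (Leaf (V', E', v, \<lambda>_. {})))"
proof (rule ty_eq_if_bisim[where R = "\<lambda>t t'. \<exists>A. (\<forall>X. A X \<subseteq> V \<union> V') \<and> t = Leaf (V \<union> V', bridge E E' u v, u, A) \<and>
    t' = Attach (Leaf (V, E, u, \<lambda>X. A X \<inter> V)) (Leaf (V', E', v, \<lambda>X. A X \<inter> V'))"], goal_cases)
  case 1
  show ?case by (intro exI[of _ "\<lambda>_. {}"]) auto
next
  case (2 t t')
  then show ?case using leaf_atoms_bridge[OF assms] by (auto simp: atoms_upto_def)
next
  case (3 t t' X t1)
  then obtain A S where A: "\<forall>X. A X \<subseteq> V \<union> V'" and S: "S \<subseteq> V \<union> V'"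
      and t: "t1 = Leaf (V \<union> V', bridge E E' u v, u, A(X := S))"
        "t' = Attach (Leaf (V, E, u, \<lambda>X. A X \<inter> V)) (Leaf (V', E', v, \<lambda>X. A X \<inter> V'))"
    by auto
  have upd: "(\<lambda>Y. (A(X := S)) Y \<inter> W) = (\<lambda>Y. A Y \<inter> W)(X := S \<inter> W)" for W
    by (simp add: fun_eq_iff)
  have "Attach (Leaf (V, E, u, \<lambda>Y. (A(X := S)) Y \<inter> V)) (Leaf (V', E', v, \<lambda>Y. (A(X := S)) Y \<inter> V')) \<in> succs X t'"
    unfolding t upd by (intro Attach_in_succs Leaf_upd_in_succs) auto
  moreover have "\<forall>Y. (A(X := S)) Y \<subseteq> V \<union> V'" using A S by simp
  ultimately show ?case using t(1) by blast
next
  case (4 t t' X t1)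
  then obtain A S S' where A: "\<forall>X. A X \<subseteq> V \<union> V'" and S: "S \<subseteq> V" "S' \<subseteq> V'"
      and t: "t = Leaf (V \<union> V', bridge E E' u v, u, A)"
        "t1 = Attach (Leaf (V, E, u, (\<lambda>X. A X \<inter> V)(X := S))) (Leaf (V', E', v, (\<lambda>X. A X \<inter> V')(X := S')))"
    by auto
  have upd: "(\<lambda>Y. (A(X := S \<union> S')) Y \<inter> V) = (\<lambda>Y. A Y \<inter> V)(X := S)"
     "(\<lambda>Y. (A(X := S \<union> S')) Y \<inter> V') = (\<lambda>Y. A Y \<inter> V')(X := S')"
    using S assms(1) by (auto simp: fun_eq_iff)
  show ?case
    by (intro bexI[of _ "Leaf (V \<union> V', bridge E E' u v, u, A(X := S \<union> S'))"] exI[of _ "A(X := S \<union> S')"] conjI)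
      (use A S t upd in auto)
qed

lemma leaf_atoms_iso:
  assumes "inj_on p V" "E \<subseteq> V \<times> V" "r \<in> V" "\<And>X. A X \<subseteq> V"
  shows "leaf_atoms (p ` V, map_prod p p ` E, p r, \<lambda>X. p ` A X) = leaf_atoms (V, E, r, A)"
proof -
  have inj: "a \<in> V \<Longrightarrow> b \<in> V \<Longrightarrow> p a = p b \<longleftrightarrow> a = b" for a b
    using assms(1) by (auto dest: inj_onD)
  have edge: "a \<in> V \<Longrightarrow> b \<in> V \<Longrightarrow> (p a, p b) \<in> map_prod p p ` E \<longleftrightarrow> (a, b) \<in> E" for a b
  proof
    assume ab: "a \<in> V" "b \<in> V" "(p a, p b) \<in> map_prod p p ` E"
    then obtain c d where cd: "(c, d) \<in> E" "p a = p c" "p b = p d" by auto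
    then have "c \<in> V" "d \<in> V" using assms by auto
    then show "(a, b) \<in> E" using cd ab inj by simp
  qed force
  have "(\<exists>a\<in>p ` A X. \<exists>b\<in>p ` A Y. (a, b) \<in> map_prod p p ` E) \<longleftrightarrow> (\<exists>a\<in>A X. \<exists>b\<in>A Y. (a, b) \<in> E)" for X Y
    using edge assms(4) by (simp add: Bex_def) (metis subsetD)
  moreover have "p ` A X \<inter> p ` A Y = p ` (A X \<inter> A Y)" for X Y
    by (rule inj_on_image_Int[symmetric, OF assms(1)]) (rule assms(4))+
  moreover have "p r \<in> p ` A X \<longleftrightarrow> r \<in> A X" for X
    by (rule inj_on_image_mem_iff[OF assms(1)]) (use assms in auto)
  moreover have "(\<exists>a\<in>p ` A X. \<exists>b\<in>p ` A X. a \<noteq> b) \<longleftrightarrow> (\<exists>a\<in>A X. \<exists>b\<in>A X. a \<noteq> b)" for X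
    using inj assms(4)[of X] by (simp add: Bex_def) (metis subsetD)
  ultimately show ?thesis unfolding leaf_atoms_def by simp
qed

text \<open>Sets are carried along \<open>p\<close>, and each move is answered by its image or
  preimage.\<close>

lemma ty_iso:
  assumes "inj_on p V" "E \<subseteq> V \<times> V" "r \<in> V"
  shows "ty k q (Leaf (p ` V, map_prod p p ` E, p r, \<lambda>_. {})) = ty k q (Leaf (V, E, r, \<lambda>_. {}))"
proof (rule ty_eq_if_bisim[where R = "\<lambda>t t'. \<exists>A. (\<forall>X. A X \<subseteq> V) \<and>
    t = Leaf (p ` V, map_prod p p ` E, p r, \<lambda>X. p ` A X) \<and> t' = Leaf (V, E, r, A)"], goal_cases)
  case 1
  show ?case by (intro exI[of _ "\<lambda>_. {}"]) auto
next
  case (2 t t')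
  then show ?case using leaf_atoms_iso[OF assms] by (auto simp: atoms_upto_def)
next
  case (3 t t' X t1)
  then obtain A S where A: "\<forall>X. A X \<subseteq> V" and S: "S \<subseteq> V"
      and t: "t1 = Leaf (p ` V, map_prod p p ` E, p r, (\<lambda>X. p ` A X)(X := p ` S))" "t' = Leaf (V, E, r, A)"
    by (auto simp: subset_image_iff)
  show ?case
    by (intro bexI[of _ "Leaf (V, E, r, A(X := S))"] exI[of _ "A(X := S)"])
      (use A S t in \<open>auto simp: fun_eq_iff\<close>)
next
  case (4 t t' X t1)
  then obtain A S where A: "\<forall>X. A X \<subseteq> V" and S: "S \<subseteq> V"
      and t: "t = Leaf (p ` V, map_prod p p ` E, p r, \<lambda>X. p ` A X)" "t1 = Leaf (V, E, r, A(X := S))"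
    by auto
  have upd: "(\<lambda>Y. p ` (A(X := S)) Y) = (\<lambda>Y. p ` A Y)(X := p ` S)" by (simp add: fun_eq_iff)
  have "Leaf (p ` V, map_prod p p ` E, p r, \<lambda>Y. p ` (A(X := S)) Y) \<in> succs X t"
    unfolding t upd by (intro Leaf_upd_in_succs image_mono S)
  moreover have "\<forall>Y. (A(X := S)) Y \<subseteq> V" using A S by simp
  ultimately show ?case using t(2) by blast
qed

section \<open>Types determine the truth of MSO formulas\<close>

primrec qrank :: "mso \<Rightarrow> nat" where
  "qrank (In x X) = 0"
| "qrank (Edge x y) = 0"
| "qrank (Neg \<phi>) = qrank \<phi>"
| "qrank (Conj \<phi> \<psi>) = max (qrank \<phi>) (qrank \<psi>)"
| "qrank (Disj \<phi> \<psi>) = max (qrank \<phi>) (qrank \<psi>)"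
| "qrank (Ex1 x \<phi>) = Suc (qrank \<phi>)"
| "qrank (All1 x \<phi>) = Suc (qrank \<phi>)"
| "qrank (Ex2 X \<phi>) = Suc (qrank \<phi>)"
| "qrank (All2 X \<phi>) = Suc (qrank \<phi>)"

text \<open>Quantified variables count as well, because the game reassigns their sets.\<close>

primrec var_bound :: "mso \<Rightarrow> nat" where
  "var_bound (In x X) = Suc (max x X)"
| "var_bound (Edge x y) = Suc (max x y)"
| "var_bound (Neg \<phi>) = var_bound \<phi>"
| "var_bound (Conj \<phi> \<psi>) = max (var_bound \<phi>) (var_bound \<psi>)"
| "var_bound (Disj \<phi> \<psi>) = max (var_bound \<phi>) (var_bound \<psi>)"
| "var_bound (Ex1 x \<phi>) = max (Suc x) (var_bound \<phi>)"
| "var_bound (All1 x \<phi>) = max (Suc x) (var_bound \<phi>)"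
| "var_bound (Ex2 X \<phi>) = max (Suc X) (var_bound \<phi>)"
| "var_bound (All2 X \<phi>) = max (Suc X) (var_bound \<phi>)"

text \<open>In a structure \<open>(V, E, r, B)\<close> the set with index \<open>2 x\<close> is the singleton of the value of the
  vertex variable \<open>x\<close>, and the set with index \<open>2 X + 1\<close> is the value of the set variable \<open>X\<close>.\<close>

definition encodes :: "mso \<Rightarrow> nat set \<Rightarrow> (nat \<Rightarrow> nat) \<Rightarrow> (nat \<Rightarrow> nat set) \<Rightarrow> (nat \<Rightarrow> nat set) \<Rightarrow> bool" where
  "encodes \<phi> V a A B \<longleftrightarrow>
     (\<forall>x\<in>free1 \<phi>. a x \<in> V \<and> B (2 * x) = {a x}) \<and> (\<forall>X\<in>free2 \<phi>. B (2 * X + 1) = A X)"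

text \<open>A vertex move is played as a singleton. Tags 1 and 3 of its atoms force the answer to be
  a singleton too.\<close>

lemma ty_eq_singleton_step:
  assumes eq: "ty k (Suc q) (Leaf (V, E, r, B)) = ty k (Suc q) (Leaf (V', E', r', B'))"
    and "X < k" "v \<in> V"
  obtains v' where "v' \<in> V'"
    "ty k q (Leaf (V, E, r, B(X := {v}))) = ty k q (Leaf (V', E', r', B'(X := {v'})))"
proof -
  have "Leaf (V, E, r, B(X := {v})) \<in> succs X (Leaf (V, E, r, B))"
    using assms(3) by auto
  from ty_Suc_eqD[OF eq assms(2) this] obtain S where S: "S \<subseteq> V'"
    and ty: "ty k q (Leaf (V, E, r, B(X := {v}))) = ty k q (Leaf (V', E', r', B'(X := S)))"
    by auto
  have eq: "atoms_upto k (Leaf (V, E, r, B(X := {v}))) = atoms_upto k (Leaf (V', E', r', B'(X := S)))"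
    by (rule ty_eq_imp_atoms[OF ty])
  have "(1, X, X) \<in> atoms_upto k (Leaf (V, E, r, B(X := {v})))"
    "(3, X, X) \<notin> atoms_upto k (Leaf (V, E, r, B(X := {v})))"
    using assms(2) by (auto simp: atoms_upto_def leaf_atoms_def)
  then have "S \<noteq> {}" "\<forall>a\<in>S. \<forall>b\<in>S. a = b"
    unfolding eq using assms(2) by (auto simp: atoms_upto_def leaf_atoms_def)
  then obtain v' where "S = {v'}" by blast
  then show ?thesis using that ty S by auto
qed

lemma ty_eq_set_step:
  assumes eq: "ty k (Suc q) (Leaf (V, E, r, B)) = ty k (Suc q) (Leaf (V', E', r', B'))"
    and "X < k" "S \<subseteq> V"
  obtains S' where "S' \<subseteq> V'"
    "ty k q (Leaf (V, E, r, B(X := S))) = ty k q (Leaf (V', E', r', B'(X := S')))"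
proof -
  have "Leaf (V, E, r, B(X := S)) \<in> succs X (Leaf (V, E, r, B))"
    by (rule Leaf_upd_in_succs[OF assms(3)])
  from ty_Suc_eqD[OF eq assms(2) this] obtain t where "t \<in> succs X (Leaf (V', E', r', B'))"
    and t: "ty k q (Leaf (V, E, r, B(X := S))) = ty k q t" .
  then obtain S' where "S' \<subseteq> V'" "t = Leaf (V', E', r', B'(X := S'))" by auto
  with t that show ?thesis by simp
qed

text \<open>The factor in \<open>2 * b\<close> arises because vertex and set variables share the
  indices of sets, as even and odd numbers. Each quantifier uses up one round; the atomic formulas
  are read off tags 1 and 0.\<close>

lemma sat_eq_if_ty_eq:
  assumes "qrank \<phi> \<le> q" "var_bound \<phi> \<le> b"
    and "ty (2 * b) q (Leaf (pverts G, parcs G, r, B)) = ty (2 * b) q (Leaf (pverts G', parcs G', r', B'))"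
    and "encodes \<phi> (pverts G) a A B" "encodes \<phi> (pverts G') a' A' B'"
  shows "sat G a A \<phi> \<longleftrightarrow> sat G' a' A' \<phi>"
  using assms
proof (induction \<phi> arbitrary: q a A B a' A' B')
  case (In x X)
  have "(1, 2 * x, 2 * X + 1) \<in> atoms_upto (2 * b) (Leaf (pverts G, parcs G, r, B)) \<longleftrightarrow>
      (1, 2 * x, 2 * X + 1) \<in> atoms_upto (2 * b) (Leaf (pverts G', parcs G', r', B'))"
    by (simp only: ty_eq_imp_atoms[OF In.prems(3)])
  then show ?case
    using In.prems by (auto simp: atoms_upto_def leaf_atoms_def encodes_def)
next
  case (Edge x y)
  have "(0, 2 * x, 2 * y) \<in> atoms_upto (2 * b) (Leaf (pverts G, parcs G, r, B)) \<longleftrightarrow>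
      (0, 2 * x, 2 * y) \<in> atoms_upto (2 * b) (Leaf (pverts G', parcs G', r', B'))"
    by (simp only: ty_eq_imp_atoms[OF Edge.prems(3)])
  then show ?case
    using Edge.prems by (auto simp: atoms_upto_def leaf_atoms_def encodes_def)
next
  case (Neg \<phi>)
  have "sat G a A \<phi> \<longleftrightarrow> sat G' a' A' \<phi>"
    by (rule Neg.IH[OF _ _ Neg.prems(3)]) (use Neg.prems in \<open>auto simp: encodes_def\<close>)
  then show ?case by simp
next
  case (Conj \<phi> \<psi>)
  have "sat G a A \<phi> \<longleftrightarrow> sat G' a' A' \<phi>"
    by (rule Conj.IH(1)[OF _ _ Conj.prems(3)]) (use Conj.prems in \<open>auto simp: encodes_def\<close>)
  moreover have "sat G a A \<psi> \<longleftrightarrow> sat G' a' A' \<psi>"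
    by (rule Conj.IH(2)[OF _ _ Conj.prems(3)]) (use Conj.prems in \<open>auto simp: encodes_def\<close>)
  ultimately show ?case by simp
next
  case (Disj \<phi> \<psi>)
  have "sat G a A \<phi> \<longleftrightarrow> sat G' a' A' \<phi>"
    by (rule Disj.IH(1)[OF _ _ Disj.prems(3)]) (use Disj.prems in \<open>auto simp: encodes_def\<close>)
  moreover have "sat G a A \<psi> \<longleftrightarrow> sat G' a' A' \<psi>"
    by (rule Disj.IH(2)[OF _ _ Disj.prems(3)]) (use Disj.prems in \<open>auto simp: encodes_def\<close>)
  ultimately show ?case by simp
next
  case (Ex1 x \<phi>)
  obtain q' where q: "q = Suc q'" "qrank \<phi> \<le> q'" using Ex1.prems(1) by (cases q) auto
  have x: "2 * x < 2 * b" using Ex1.prems(2) by simp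
  have step: "sat G (a(x := v)) A \<phi> \<longleftrightarrow> sat G' (a'(x := v')) A' \<phi>"
    if "v \<in> pverts G" "v' \<in> pverts G'"
      "ty (2 * b) q' (Leaf (pverts G, parcs G, r, B(2 * x := {v}))) =
       ty (2 * b) q' (Leaf (pverts G', parcs G', r', B'(2 * x := {v'})))" for v v'
    by (rule Ex1.IH[OF q(2) _ that(3)])
      (use Ex1.prems that in \<open>auto simp: encodes_def double_not_eq_Suc_double Suc_double_not_eq_double\<close>)
  show ?case
  proof
    assume "sat G a A (Ex1 x \<phi>)"
    then obtain v where v: "v \<in> pverts G" "sat G (a(x := v)) A \<phi>" by auto
    from ty_eq_singleton_step[OF Ex1.prems(3)[unfolded q(1)] x v(1)] v step
    show "sat G' a' A' (Ex1 x \<phi>)" by (metis sat.simps(6))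
  next
    assume "sat G' a' A' (Ex1 x \<phi>)"
    then obtain v where v: "v \<in> pverts G'" "sat G' (a'(x := v)) A' \<phi>" by auto
    from ty_eq_singleton_step[OF Ex1.prems(3)[unfolded q(1), symmetric] x v(1)] v step
    show "sat G a A (Ex1 x \<phi>)" by (metis sat.simps(6))
  qed
next
  case (All1 x \<phi>)
  obtain q' where q: "q = Suc q'" "qrank \<phi> \<le> q'" using All1.prems(1) by (cases q) auto
  have x: "2 * x < 2 * b" using All1.prems(2) by simp
  have step: "sat G (a(x := v)) A \<phi> \<longleftrightarrow> sat G' (a'(x := v')) A' \<phi>"
    if "v \<in> pverts G" "v' \<in> pverts G'"
      "ty (2 * b) q' (Leaf (pverts G, parcs G, r, B(2 * x := {v}))) =
       ty (2 * b) q' (Leaf (pverts G', parcs G', r', B'(2 * x := {v'})))" for v v'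
    by (rule All1.IH[OF q(2) _ that(3)])
      (use All1.prems that in \<open>auto simp: encodes_def double_not_eq_Suc_double Suc_double_not_eq_double\<close>)
  show ?case
  proof
    assume *: "sat G a A (All1 x \<phi>)"
    have "sat G' (a'(x := v)) A' \<phi>" if v: "v \<in> pverts G'" for v
      using ty_eq_singleton_step[OF All1.prems(3)[unfolded q(1), symmetric] x v] v step *
      by (metis sat.simps(7))
    then show "sat G' a' A' (All1 x \<phi>)" by simp
  next
    assume *: "sat G' a' A' (All1 x \<phi>)"
    have "sat G (a(x := v)) A \<phi>" if v: "v \<in> pverts G" for v
      using ty_eq_singleton_step[OF All1.prems(3)[unfolded q(1)] x v] v step *
      by (metis sat.simps(7))
    then show "sat G a A (All1 x \<phi>)" by simp
  qed
next
  case (Ex2 X \<phi>)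
  obtain q' where q: "q = Suc q'" "qrank \<phi> \<le> q'" using Ex2.prems(1) by (cases q) auto
  have x: "2 * X + 1 < 2 * b" using Ex2.prems(2) by simp
  have step: "sat G a (A(X := S)) \<phi> \<longleftrightarrow> sat G' a' (A'(X := S')) \<phi>"
    if "ty (2 * b) q' (Leaf (pverts G, parcs G, r, B(2 * X + 1 := S))) =
       ty (2 * b) q' (Leaf (pverts G', parcs G', r', B'(2 * X + 1 := S')))" for S S'
    by (rule Ex2.IH[OF q(2) _ that])
      (use Ex2.prems in \<open>auto simp: encodes_def double_not_eq_Suc_double Suc_double_not_eq_double\<close>)
  show ?case
  proof
    assume "sat G a A (Ex2 X \<phi>)"
    then obtain S where S: "S \<subseteq> pverts G" "sat G a (A(X := S)) \<phi>" by auto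
    from ty_eq_set_step[OF Ex2.prems(3)[unfolded q(1)] x S(1)] S step
    show "sat G' a' A' (Ex2 X \<phi>)" by (metis sat.simps(8))
  next
    assume "sat G' a' A' (Ex2 X \<phi>)"
    then obtain S where S: "S \<subseteq> pverts G'" "sat G' a' (A'(X := S)) \<phi>" by auto
    from ty_eq_set_step[OF Ex2.prems(3)[unfolded q(1), symmetric] x S(1)] S step
    show "sat G a A (Ex2 X \<phi>)" by (metis sat.simps(8))
  qed
next
  case (All2 X \<phi>)
  obtain q' where q: "q = Suc q'" "qrank \<phi> \<le> q'" using All2.prems(1) by (cases q) auto
  have x: "2 * X + 1 < 2 * b" using All2.prems(2) by simp
  have step: "sat G a (A(X := S)) \<phi> \<longleftrightarrow> sat G' a' (A'(X := S')) \<phi>"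
    if "ty (2 * b) q' (Leaf (pverts G, parcs G, r, B(2 * X + 1 := S))) =
       ty (2 * b) q' (Leaf (pverts G', parcs G', r', B'(2 * X + 1 := S')))" for S S'
    by (rule All2.IH[OF q(2) _ that])
      (use All2.prems in \<open>auto simp: encodes_def double_not_eq_Suc_double Suc_double_not_eq_double\<close>)
  show ?case
  proof
    assume *: "sat G a A (All2 X \<phi>)"
    have "sat G' a' (A'(X := S)) \<phi>" if S: "S \<subseteq> pverts G'" for S
      using ty_eq_set_step[OF All2.prems(3)[unfolded q(1), symmetric] x S] S step *
      by (metis sat.simps(9))
    then show "sat G' a' A' (All2 X \<phi>)" by simp
  next
    assume *: "sat G' a' A' (All2 X \<phi>)"
    have "sat G a (A(X := S)) \<phi>" if S: "S \<subseteq> pverts G" for S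
      using ty_eq_set_step[OF All2.prems(3)[unfolded q(1)] x S] S step *
      by (metis sat.simps(9))
    then show "sat G a A (All2 X \<phi>)" by simp
  qed
qed

section \<open>Universal and absorbing graphs\<close>

lemma bridge_image:
  "map_prod p p ` bridge E E' u v = bridge (map_prod p p ` E) (map_prod p p ` E') (p u) (p v)"
  unfolding bridge_def by (simp add: image_Un)

lemma map_prod_image_subset: "E \<subseteq> V \<times> V \<Longrightarrow> map_prod p p ` E \<subseteq> p ` V \<times> p ` V"
  by auto

section \<open>Classes of connected graphs closed under bridges\<close>

text \<open>Connectedness through cuts, the form in which the arguments on bridges use it.\<close>

definition cut_connected :: "nat set \<Rightarrow> nat rel \<Rightarrow> bool" where
  "cut_connected V E \<longleftrightarrow> V \<noteq> {} \<and> (\<forall>S\<subseteq>V. S \<noteq> {} \<longrightarrow> S \<noteq> V \<longrightarrow> (\<exists>a\<in>S. \<exists>b\<in>V - S. (a, b) \<in> E))"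

abbreviation rooted :: "nat set \<Rightarrow> nat rel \<Rightarrow> nat \<Rightarrow> gterm" where
  "rooted V E r \<equiv> Leaf (V, E, r, \<lambda>_. {})"

text \<open>\<open>K\<close> abstracts the connected members of an addable class;
  \<open>bridge_class_Conn\<close> supplies the instance.\<close>

locale bridge_class =
  fixes K :: "nat set \<Rightarrow> nat rel \<Rightarrow> bool"
  assumes K_finite: "K V E \<Longrightarrow> finite V"
    and K_edges: "K V E \<Longrightarrow> E \<subseteq> V \<times> V"
    and K_sym: "K V E \<Longrightarrow> sym E"
    and K_connected: "K V E \<Longrightarrow> cut_connected V E"
    and K_iso: "K V E \<Longrightarrow> inj_on p V \<Longrightarrow> K (p ` V) (map_prod p p ` E)"
    and K_bridge: "K V E \<Longrightarrow> K V' E' \<Longrightarrow> V \<inter> V' = {} \<Longrightarrow> u \<in> V \<Longrightarrow> v \<in> V' \<Longrightarrow> K (V \<union> V') (bridge E E' u v)"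
begin

lemma K_disjoint_copy:
  assumes "finite U"
  obtains p :: "nat \<Rightarrow> nat" where "inj p" "p ` V \<inter> U = {}"
proof
  show "inj ((+) (Suc (Max U)))" by simp
  show "(+) (Suc (Max U)) ` V \<inter> U = {}"
    using Max_ge[OF assms] by fastforce
qed

text \<open>Fresh disjoint copies are bridged to \<open>r\<close> one after the other, so a formal
  gluing of members has the type of an actual member.\<close>

lemma glue_realised:
  assumes "K V E" "r \<in> V" "\<forall>(V', E', r')\<in>set gs. K V' E' \<and> r' \<in> V'"
  shows "\<exists>V2 E2. K V2 E2 \<and> r \<in> V2 \<and>
    ty k q (rooted V2 E2 r) = ty k q (glue (rooted V E r) (map (\<lambda>(V', E', r'). rooted V' E' r') gs))"
  using assms(3)
proof (induction gs)
  case Nil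
  then show ?case using assms by auto
next
  case (Cons g gs)
  obtain V' E' r' where g: "g = (V', E', r')" by (cases g)
  from Cons obtain V2 E2 where 2: "K V2 E2" "r \<in> V2"
    "ty k q (rooted V2 E2 r) = ty k q (glue (rooted V E r) (map (\<lambda>(V', E', r'). rooted V' E' r') gs))"
    by auto
  have g': "K V' E'" "r' \<in> V'" using Cons.prems g by auto
  obtain p where p: "inj p" "p ` V' \<inter> V2 = {}" using K_disjoint_copy[OF K_finite[OF 2(1)]] .
  have inj: "inj_on p V'" using p(1) by (rule inj_on_subset) simp
  let ?E' = "map_prod p p ` E'"
  have K': "K (p ` V') ?E'" by (rule K_iso[OF g'(1) inj])
  have disj: "V2 \<inter> p ` V' = {}" using p by auto
  have "K (V2 \<union> p ` V') (bridge E2 ?E' r (p r'))"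
    by (rule K_bridge[OF 2(1) K' disj]) (use 2 g' in auto)
  moreover have "ty k q (rooted (V2 \<union> p ` V') (bridge E2 ?E' r (p r')) r) =
      ty k q (glue (rooted V E r) (map (\<lambda>(V', E', r'). rooted V' E' r') (g # gs)))"
  proof -
    have "ty k q (rooted (V2 \<union> p ` V') (bridge E2 ?E' r (p r')) r) =
        ty k q (Attach (rooted V2 E2 r) (rooted (p ` V') ?E' (p r')))"
      by (rule ty_bridge) (use 2 g' K' disj K_edges in auto)
    also have "\<dots> = ty k q (glue (rooted V E r) (map (\<lambda>(V', E', r'). rooted V' E' r') (g # gs)))"
      unfolding g list.map glue.simps prod.case
      by (rule ty_Attach_cong) (use 2(3) ty_iso[OF inj] K_edges g' in auto)
    finally show ?thesis .
  qed
  ultimately show ?case using 2 by blast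
qed

lemma length_filter_concat_replicate:
  assumes "x \<in> set xs" "P (g x)"
  shows "n \<le> length (filter P (concat (map (\<lambda>x. replicate n (g x)) xs)))"
proof -
  obtain ys zs where "xs = ys @ x # zs" using split_list[OF assms(1)] by auto
  then show ?thesis using assms(2) by simp
qed

text \<open>The graph carries, at one root, \<open>thr k q\<close> copies of a representative of
  each type of members. Any further member attached there is an extra copy of one that is present
  often enough.\<close>

lemma universal_graph:
  assumes "K V0 E0"
  obtains V E r where "K V E" "r \<in> V"
    "\<And>V' E' r'. K V' E' \<Longrightarrow> r' \<in> V' \<Longrightarrow>
      ty k q (Attach (rooted V E r) (rooted V' E' r')) = ty k q (rooted V E r)"
proof -
  have "V0 \<noteq> {}" using K_connected[OF assms] by (simp add: cut_connected_def)
  then obtain r where r: "r \<in> V0" by auto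
  define G where "G = {(V, E, r). K V E \<and> r \<in> V}"
  define t where "t = (\<lambda>(V, E, r). ty k q (rooted V E r))"
  have "finite (t ` G)"
    by (rule finite_subset[OF _ finite_range_ty[of k q]]) (auto simp: t_def)
  then obtain xs where xs: "set xs = t ` G" using finite_list by metis
  define rep where "rep = inv_into G t"
  have rep: "rep \<tau> \<in> G" "t (rep \<tau>) = \<tau>" if "\<tau> \<in> t ` G" for \<tau>
    using that unfolding rep_def by (auto simp: inv_into_into f_inv_into_f)
  define gs where "gs = concat (map (\<lambda>\<tau>. replicate (thr k q) (rep \<tau>)) xs)"
  have "\<forall>(V', E', r')\<in>set gs. K V' E' \<and> r' \<in> V'"
    using rep(1) xs unfolding gs_def G_def by fastforce
  from glue_realised[OF assms r this, where k = k and q = q] obtain V E where N: "K V E" "r \<in> V"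
    "ty k q (rooted V E r) = ty k q (glue (rooted V0 E0 r) (map (\<lambda>(V', E', r'). rooted V' E' r') gs))"
    by auto
  let ?hs = "map (\<lambda>(V', E', r'). rooted V' E' r') gs"
  have ty_hs: "ty k q (case g of (V', E', r') \<Rightarrow> rooted V' E' r') = t g" for g
    by (simp add: t_def split: prod.splits)
  have "ty k q (Attach (rooted V E r) (rooted V' E' r')) = ty k q (rooted V E r)"
    if "K V' E'" "r' \<in> V'" for V' E' r'
  proof -
    let ?\<tau> = "ty k q (rooted V' E' r')"
    have \<tau>: "?\<tau> \<in> t ` G" using that by (force simp: t_def G_def)
    have "thr k q \<le> length (filter (\<lambda>g. t g = ?\<tau>) gs)"
      unfolding gs_def by (rule length_filter_concat_replicate[of ?\<tau>]) (use \<tau> xs rep in auto)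
    also have "\<dots> = card {i. i < length ?hs \<and> ty k q (?hs ! i) = ?\<tau>}"
      by (simp add: length_filter_conv_card ty_hs cong: conj_cong)
    finally have "ty k q (glue (rooted V0 E0 r) (rooted V' E' r' # ?hs)) = ty k q (glue (rooted V0 E0 r) ?hs)"
      by (rule ty_glue_extra_copy)
    moreover have "ty k q (Attach (rooted V E r) (rooted V' E' r')) =
        ty k q (glue (rooted V0 E0 r) (rooted V' E' r' # ?hs))"
      unfolding glue.simps by (rule ty_Attach_cong) (use N in auto)
    ultimately show ?thesis using N by simp
  qed
  with N that show ?thesis by blast
qed

text \<open>\<open>\<phi>\<close> runs over the copies of the graph and \<open>(V', E')\<close> over
  what a copy is bridged to; only the whole must be a member. The root \<open>y\<close> is left
  open, because sentences do not mention it.\<close>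

definition absorbing :: "nat \<Rightarrow> nat \<Rightarrow> nat set \<Rightarrow> nat rel \<Rightarrow> nat \<Rightarrow> nat \<Rightarrow> bool" where
  "absorbing k q V E x \<nu> \<longleftrightarrow> (\<forall>\<phi> V' E' v. inj_on \<phi> V \<longrightarrow> E' \<subseteq> V' \<times> V' \<longrightarrow> V' \<inter> \<phi> ` V = {} \<longrightarrow> v \<in> V' \<longrightarrow>
      K (\<phi> ` V \<union> V') (bridge (map_prod \<phi> \<phi> ` E) E' (\<phi> x) v) \<longrightarrow>
      (\<exists>y. ty k q (rooted (\<phi> ` V \<union> V') (bridge (map_prod \<phi> \<phi> ` E) E' (\<phi> x) v) y) = \<nu>))"

text \<open>Attaching a graph \<open>R\<close> with a root of type \<open>\<tau>\<close> to the universal graph \<open>N\<close> changes the type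
  by a map \<open>f\<close>.  The map \<open>f\<close> is constant on the types of members of the class, but \<open>R\<close> need not
  be a member.  In a long chain of copies of \<open>N\<close> the iterates of \<open>f\<close> still reach the constant,
  provided that the resulting graph is a member.\<close>

lemma absorbing_graph:
  assumes "K V0 E0"
  obtains V E x \<nu> where "K V E" "x \<in> V" "absorbing k q V E x \<nu>"
proof -
  obtain N F r where N: "K N F" "r \<in> N" and
    univ: "\<And>V' E' r'. K V' E' \<Longrightarrow> r' \<in> V' \<Longrightarrow>
      ty k q (Attach (rooted N F r) (rooted V' E' r')) = ty k q (rooted N F r)"
    by (rule universal_graph[OF assms, of k q]) blast
  define \<nu> where "\<nu> = ty k q (rooted N F r)"
  \<comment> \<open>\<open>f\<close> is the action on types of attachment to \<open>N\<close>, well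
    defined by congruence.\<close>
  define f where "f \<tau> = ty k q (Attach (rooted N F r) (inv (ty k q) \<tau>))" for \<tau>
  have f: "f (ty k q t) = ty k q (Attach (rooted N F r) t)" for t
    unfolding f_def by (rule ty_Attach_cong) (simp_all add: f_inv_into_f)
  define S where "S = {ty k q (rooted V E r) | V E r. K V E \<and> r \<in> V}"
  have f_S: "f \<tau> = \<nu>" if "\<tau> \<in> S" for \<tau>
    using that univ unfolding S_def \<nu>_def by (auto simp: f)
  have "\<nu> \<in> S" unfolding S_def \<nu>_def using N by auto
  \<comment> \<open>\<open>\<nu>\<close> is a fixed point of \<open>f\<close> in \<open>S\<close>,
    so an orbit that meets \<open>S\<close> is constantly \<open>\<nu>\<close> afterwards.\<close>
  have stable: "(f ^^ (m + Suc i)) \<tau> = \<nu>" if "(f ^^ i) \<tau> \<in> S" for m i \<tau>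
    by (induction m) (use that f_S \<open>\<nu> \<in> S\<close> in auto)
  have "\<exists>n. \<forall>m\<ge>n. (\<exists>i. (f ^^ i) \<tau> \<in> S) \<longrightarrow> (f ^^ m) \<tau> = \<nu>" for \<tau>
  proof (cases "\<exists>i. (f ^^ i) \<tau> \<in> S")
    case True
    then obtain i where "(f ^^ i) \<tau> \<in> S" ..
    then have "\<forall>m\<ge>Suc i. (f ^^ m) \<tau> = \<nu>" using stable by (metis le_add_diff_inverse2)
    then show ?thesis by blast
  qed auto
  then obtain n where n: "\<And>\<tau> m. m \<ge> n \<tau> \<Longrightarrow> \<exists>i. (f ^^ i) \<tau> \<in> S \<Longrightarrow> (f ^^ m) \<tau> = \<nu>"
    by metis
  \<comment> \<open>There are finitely many types, so one length serves all orbits: the sum bounds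
    each \<open>n \<tau>\<close>.\<close>
  define l where "l = (\<Sum>\<tau>\<in>range (ty k q). n \<tau>)"
  have l: "(f ^^ Suc l) (ty k q t) = \<nu>" if "(f ^^ Suc l) (ty k q t) \<in> S" for t
  proof -
    have "n (ty k q t) \<le> l" unfolding l_def
      by (rule member_le_sum) (use finite_range_ty in auto)
    then show ?thesis using n[of "ty k q t" "Suc l"] that by (meson le_SucI)
  qed
  \<comment> \<open>This describes a chain of \<open>m\<close> copies of \<open>N\<close>: the rest
    is attached at one end \<open>x\<close>, the type is read at the other end \<open>y\<close>, and
    \<open>f\<close> acts once for each copy.\<close>
  define good where "good m V E x y \<longleftrightarrow> (\<forall>V' E' v. E' \<subseteq> V' \<times> V' \<longrightarrow> V' \<inter> V = {} \<longrightarrow> v \<in> V' \<longrightarrow>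
      ty k q (rooted (V \<union> V') (bridge E E' x v) y) = (f ^^ m) (ty k q (rooted V' E' v)))" for m V E x y
  have "\<exists>V E x y. K V E \<and> x \<in> V \<and> y \<in> V \<and>
      (\<forall>\<phi>. inj_on \<phi> V \<longrightarrow> good (Suc m) (\<phi> ` V) (map_prod \<phi> \<phi> ` E) (\<phi> x) (\<phi> y))" for m
  proof (induction m)
    case 0
    have "good 1 (\<phi> ` N) (map_prod \<phi> \<phi> ` F) (\<phi> r) (\<phi> r)" if inj: "inj_on \<phi> N" for \<phi>
      unfolding good_def
    proof (intro allI impI)
      fix V' E' v assume *: "E' \<subseteq> V' \<times> V'" "V' \<inter> \<phi> ` N = {}" "(v :: nat) \<in> V'"
      have "ty k q (rooted (\<phi> ` N \<union> V') (bridge (map_prod \<phi> \<phi> ` F) E' (\<phi> r) v) (\<phi> r)) =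
          ty k q (Attach (rooted (\<phi> ` N) (map_prod \<phi> \<phi> ` F) (\<phi> r)) (rooted V' E' v))"
        by (rule ty_bridge)
          (use * N K_edges[OF N(1), THEN map_prod_image_subset[of _ _ \<phi>]] in auto)
      also have "\<dots> = f (ty k q (rooted V' E' v))"
        unfolding f by (rule ty_Attach_cong) (use ty_iso[OF inj] N K_edges in auto)
      finally show "ty k q (rooted (\<phi> ` N \<union> V') (bridge (map_prod \<phi> \<phi> ` F) E' (\<phi> r) v) (\<phi> r)) =
          (f ^^ 1) (ty k q (rooted V' E' v))" by simp
    qed
    then show ?case using N by (intro exI[of _ N] exI[of _ F] exI[of _ r]) auto
  next
    case (Suc m)
    then obtain V E x y where M: "K V E" "x \<in> V" "y \<in> V"
      and good: "\<And>\<phi>. inj_on \<phi> V \<Longrightarrow> good (Suc m) (\<phi> ` V) (map_prod \<phi> \<phi> ` E) (\<phi> x) (\<phi> y)"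
      by auto
    obtain p where p: "inj p" "p ` N \<inter> V = {}" using K_disjoint_copy[OF K_finite[OF M(1)]] .
    have inj: "inj_on p N" using p(1) by (rule inj_on_subset) simp
    let ?F = "map_prod p p ` F"
    have KpN: "K (p ` N) ?F" by (rule K_iso[OF N(1) inj])
    \<comment> \<open>The new copy of \<open>N\<close> is bridged by its root to the old end
      \<open>y\<close>, and its root becomes the new end; \<open>x\<close> stays.\<close>
    let ?V = "p ` N \<union> V" and ?E = "bridge ?F E (p r) y"
    have "K ?V ?E" by (rule K_bridge[OF KpN M(1) p(2)]) (use M N in auto)
    moreover have "good (Suc (Suc m)) (\<phi> ` ?V) (map_prod \<phi> \<phi> ` ?E) (\<phi> x) (\<phi> (p r))"
      if inj_\<phi>: "inj_on \<phi> ?V" for \<phi>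
      unfolding good_def
    proof (intro allI impI)
      fix V' E' v assume *: "E' \<subseteq> V' \<times> V'" "V' \<inter> \<phi> ` ?V = {}" "(v :: nat) \<in> V'"
      let ?\<psi> = "\<phi> \<circ> p"
      have inj_\<psi>: "inj_on ?\<psi> N" using inj inj_\<phi> by (auto intro: comp_inj_on inj_on_subset)
      have inj_V: "inj_on \<phi> V" using inj_\<phi> by (rule inj_on_subset) simp
      let ?U = "\<phi> ` V \<union> V'" and ?D = "bridge (map_prod \<phi> \<phi> ` E) E' (\<phi> x) v"
      have \<psi>F: "map_prod \<phi> \<phi> ` ?F = map_prod ?\<psi> ?\<psi> ` F"
        by (simp add: image_image map_prod_compose[symmetric] map_prod_def case_prod_beta)
      have U: "ty k q (rooted ?U ?D (\<phi> y)) = (f ^^ Suc m) (ty k q (rooted V' E' v))"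
        using good[OF inj_V] * unfolding good_def by (simp add: Int_Un_distrib image_Un)
      have disj: "?\<psi> ` N \<inter> ?U = {}"
      proof -
        have "\<phi> ` (p ` N) \<inter> \<phi> ` V = \<phi> ` (p ` N \<inter> V)"
          by (rule inj_on_image_Int[symmetric, OF inj_\<phi>]) auto
        then show ?thesis using p(2) *(2) by (auto simp: image_comp)
      qed
      have D: "?D \<subseteq> ?U \<times> ?U"
        using K_edges[OF M(1), THEN map_prod_image_subset[of _ _ \<phi>]] M * unfolding bridge_def by auto
      have eq: "\<phi> ` ?V \<union> V' = ?\<psi> ` N \<union> ?U"
        by (simp add: image_Un image_comp Un_assoc)
      \<comment> \<open>The same edges grouped anew: the new copy on one side, the old chain
        together with the rest on the other.\<close>
      have eq': "bridge (map_prod \<phi> \<phi> ` ?E) E' (\<phi> x) v = bridge (map_prod ?\<psi> ?\<psi> ` F) ?D (?\<psi> r) (\<phi> y)"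
        unfolding bridge_image \<psi>F unfolding bridge_def by (simp add: Un_ac insert_commute)
      have "ty k q (rooted (?\<psi> ` N \<union> ?U) (bridge (map_prod ?\<psi> ?\<psi> ` F) ?D (?\<psi> r) (\<phi> y)) (?\<psi> r)) =
          ty k q (Attach (rooted (?\<psi> ` N) (map_prod ?\<psi> ?\<psi> ` F) (?\<psi> r)) (rooted ?U ?D (\<phi> y)))"
        by (rule ty_bridge)
          (use disj D K_edges[OF N(1), THEN map_prod_image_subset[of _ _ ?\<psi>]] N M in auto)
      also have "\<dots> = f (ty k q (rooted ?U ?D (\<phi> y)))"
        unfolding f by (rule ty_Attach_cong) (use ty_iso[OF inj_\<psi>] N K_edges in auto)
      finally show "ty k q (rooted (\<phi> ` ?V \<union> V') (bridge (map_prod \<phi> \<phi> ` ?E) E' (\<phi> x) v) (\<phi> (p r))) =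
          (f ^^ Suc (Suc m)) (ty k q (rooted V' E' v))"
        unfolding eq eq' U by simp
    qed
    ultimately show ?case using M N
      by (intro exI[of _ ?V] exI[of _ ?E] exI[of _ x] exI[of _ "p r"]) auto
  qed
  then obtain V E x y where M: "K V E" "x \<in> V" "y \<in> V"
      and good: "\<And>\<phi>. inj_on \<phi> V \<Longrightarrow> good (Suc l) (\<phi> ` V) (map_prod \<phi> \<phi> ` E) (\<phi> x) (\<phi> y)"
    by metis
  show ?thesis
  proof (rule that[OF M(1,2)], unfold absorbing_def, intro allI impI)
    fix \<phi> V' E' v
    assume inj: "inj_on \<phi> V" and *: "E' \<subseteq> V' \<times> V'" "V' \<inter> \<phi> ` V = {}" "(v :: nat) \<in> V'"
      and KG: "K (\<phi> ` V \<union> V') (bridge (map_prod \<phi> \<phi> ` E) E' (\<phi> x) v)"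
    let ?t = "ty k q (rooted (\<phi> ` V \<union> V') (bridge (map_prod \<phi> \<phi> ` E) E' (\<phi> x) v) (\<phi> y))"
    have t: "?t = (f ^^ Suc l) (ty k q (rooted V' E' v))"
      using good[OF inj] * unfolding good_def by blast
    \<comment> \<open>The rest may lie outside the class, but the whole is a member, which puts the
      last iterate into \<open>S\<close>.\<close>
    have "?t \<in> S" unfolding S_def using KG M(3) by blast
    then have "?t = \<nu>" using l t by simp
    then show "\<exists>y. ty k q (rooted (\<phi> ` V \<union> V') (bridge (map_prod \<phi> \<phi> ` E) E' (\<phi> x) v) y) = \<nu>" ..
  qed
qed

end

section \<open>Growth and pendant copies\<close>

text \<open>In each residue class modulo \<open>m\<close>, start from the least
  \<open>r \<ge> m\<close> with \<open>f r > 0\<close> and add \<open>m\<close> repeatedly, each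
  time gaining a factor of at least \<open>\<eta> ^ m\<close>. Residues are treated separately
  because \<open>f\<close> may vanish on some of them; \<open>r \<ge> m\<close> makes
  \<open>super\<close> applicable.\<close>

lemma supermultiplicative_lower_bound:
  fixes f :: "nat \<Rightarrow> real"
  assumes nonneg: "\<And>n. 0 \<le> f n"
    and super: "\<And>n m. 1 \<le> m \<Longrightarrow> m \<le> n \<Longrightarrow> f n * f m \<le> f (n + m)"
    and "1 \<le> m" "0 < \<eta>" "\<eta> ^ m \<le> f m"
  obtains c where "0 < c" "\<And>n. m \<le> n \<Longrightarrow> 0 < f n \<Longrightarrow> c * \<eta> ^ n \<le> f n"
proof -
  have iter: "f r * \<eta> ^ (q * m) \<le> f (r + q * m)" if "m \<le> r" for r q
  proof (induction q)
    case (Suc q)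
    have "f r * \<eta> ^ (Suc q * m) = (f r * \<eta> ^ (q * m)) * \<eta> ^ m" by (simp add: power_add)
    also have "\<dots> \<le> f (r + q * m) * f m"
      by (rule mult_mono) (use Suc assms nonneg in auto)
    also have "\<dots> \<le> f (r + q * m + m)" by (rule super) (use assms that in auto)
    finally show ?case by (simp add: algebra_simps)
  qed simp
  have "\<exists>c>0. \<forall>n\<ge>m. 0 < f n \<longrightarrow> n mod m = i \<longrightarrow> c * \<eta> ^ n \<le> f n" for i
  proof (cases "\<exists>n\<ge>m. 0 < f n \<and> n mod m = i")
    case True
    define r where "r = (LEAST n. m \<le> n \<and> 0 < f n \<and> n mod m = i)"
    have r: "m \<le> r" "0 < f r" "r mod m = i"
      using LeastI_ex[OF True] unfolding r_def by auto
    have "f r / \<eta> ^ r * \<eta> ^ n \<le> f n" if n: "m \<le> n" "0 < f n" "n mod m = i" for n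
    proof -
      have "r \<le> n" unfolding r_def by (rule Least_le) (use n in auto)
      moreover have "m dvd n - r" using n r \<open>r \<le> n\<close> mod_eq_dvd_iff_nat[of r n m] by auto
      ultimately obtain q where q: "n = r + q * m" by (metis dvdE le_add_diff_inverse mult.commute)
      have "f r / \<eta> ^ r * \<eta> ^ n = f r * \<eta> ^ (q * m)" using assms(4) by (simp add: q power_add)
      then show ?thesis using iter[OF r(1), of q] q by simp
    qed
    then show ?thesis using r(2) assms(4) by (intro exI[of _ "f r / \<eta> ^ r"]) auto
  qed (auto intro: exI[of _ 1])
  then obtain c where c: "\<And>i. 0 < c i" "\<And>n i. m \<le> n \<Longrightarrow> 0 < f n \<Longrightarrow> n mod m = i \<Longrightarrow> c i * \<eta> ^ n \<le> f n"
    by metis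
  show ?thesis
  proof (rule that[of "Min (c ` {..<m})"])
    show "0 < Min (c ` {..<m})" using c(1) assms(3) by (subst Min_gr_iff) (auto simp: lessThan_empty_iff)
    fix n assume n: "m \<le> n" "0 < f n"
    have "Min (c ` {..<m}) \<le> c (n mod m)" using assms(3) by (intro Min_le) auto
    then have "Min (c ` {..<m}) * \<eta> ^ n \<le> c (n mod m) * \<eta> ^ n"
      using assms(4) by (intro mult_right_mono) auto
    also have "\<dots> \<le> f n" by (rule c(2)[OF n refl])
    finally show "Min (c ` {..<m}) * \<eta> ^ n \<le> f n" .
  qed
qed

lemma fact_le_power_real: "fact k \<le> real k ^ k"
  by (metis fact_le_power order_refl of_nat_fact of_nat_power)

text \<open>The growth constant \<open>\<gamma>\<close> is the supremum of the roots \<open>f(n)\<^sup>1\<^sup>/\<^sup>n\<close>.  Applying the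
  third hypothesis with \<open>k\<close> a small fraction of \<open>n\<close> shows that \<open>b\<close> grows exponentially slower than
  \<open>\<gamma>\<^sup>n\<close>, whereas \<open>f\<close> does not on its support.\<close>

lemma exceptional_negligible:
  fixes f b :: "nat \<Rightarrow> real"
  assumes nonneg: "\<And>n. 0 \<le> f n"
    and small: "\<And>n. f n \<le> d ^ n" "0 < d"
    and super: "\<And>n m. 1 \<le> m \<Longrightarrow> m \<le> n \<Longrightarrow> f n * f m \<le> f (n + m)"
    and b_le: "\<And>n k. h < n \<Longrightarrow> b n * (n / H) ^ k \<le> f (n + k * h) * fact k"
    and "0 < H" "0 < \<epsilon>"
  shows "eventually (\<lambda>n. b n \<le> \<epsilon> * f n) sequentially"
proof (cases "\<exists>n\<ge>1. 0 < f n")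
  case False
  then have "f n = 0" if "1 \<le> n" for n using nonneg[of n] that by force
  \<comment> \<open>With \<open>k = 0\<close> the hypothesis reads \<open>b n \<le> f n\<close>,
    which is 0 here.\<close>
  then have "b n \<le> \<epsilon> * f n" if "h < n" for n using b_le[OF that, of 0] that by simp
  then show ?thesis unfolding eventually_sequentially by (meson Suc_le_eq)
next
  case True
  define R where "R = (\<lambda>n. root n (f n)) ` {1..}"
  define \<gamma> where "\<gamma> = Sup R"
  have R_le: "root n (f n) \<le> d" if "1 \<le> n" for n
  proof -
    have "root n (f n) \<le> root n (d ^ n)" using that small by (intro real_root_le_mono) auto
    then show ?thesis using that small by (simp add: real_root_power_cancel)
  qed
  have bdd: "bdd_above R" unfolding R_def by (intro bdd_aboveI[of _ d]) (use R_le in auto)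
  obtain n0 where n0: "1 \<le> n0" "0 < f n0" using True by auto
  have "0 < root n0 (f n0)" using n0 by simp
  also have "\<dots> \<le> \<gamma>" unfolding \<gamma>_def by (rule cSup_upper[OF _ bdd]) (use n0 in \<open>auto simp: R_def\<close>)
  finally have \<gamma>: "0 < \<gamma>" .
  have f_le: "f n \<le> \<gamma> ^ n" if "1 \<le> n" for n
  proof -
    have "root n (f n) \<le> \<gamma>" unfolding \<gamma>_def by (rule cSup_upper[OF _ bdd]) (use that in \<open>auto simp: R_def\<close>)
    then have "root n (f n) ^ n \<le> \<gamma> ^ n" using that nonneg by (intro power_mono) auto
    then show ?thesis using that nonneg by simp
  qed
  \<comment> \<open>\<open>k\<close> will be \<open>n div D\<close>, and the first bound makes each
    of the \<open>k\<close> steps gain a factor \<open>1 / 4\<close>.\<close>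
  obtain D :: nat where D: "4 * \<gamma> ^ h * H \<le> D" "1 \<le> D"
  proof -
    obtain D :: nat where "4 * \<gamma> ^ h * H \<le> D" using real_arch_simple by blast
    then show ?thesis using that[of "Suc D"] by simp
  qed
  \<comment> \<open>\<open>\<rho>\<close> is so close to 1 that replacing \<open>\<gamma>\<close> by
    \<open>\<eta> = \<gamma> / \<rho>\<close> costs only about \<open>2 ^ k\<close>, against a gain
    of \<open>4 ^ k\<close>.\<close>
  define \<rho> where "\<rho> = root D 2"
  have \<rho>: "1 < \<rho>" "\<rho> ^ D = 2" using D by (auto simp: \<rho>_def)
  define \<eta> where "\<eta> = \<gamma> / \<rho>"
  have \<eta>: "0 < \<eta>" "\<eta> < \<gamma>" using \<gamma> \<rho>(1) by (auto simp: \<eta>_def divide_less_eq)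
  have "R \<noteq> {}" by (auto simp: R_def)
  then obtain m where m: "1 \<le> m" "\<eta> < root m (f m)"
    using less_cSup_iff[OF _ bdd, of \<eta>] \<eta>(2) unfolding \<gamma>_def R_def by auto
  have "\<eta> ^ m \<le> root m (f m) ^ m" using m \<eta> by (intro power_mono) auto
  then have "\<eta> ^ m \<le> f m" using m nonneg by simp
  then obtain c where c: "0 < c" "\<And>n. m \<le> n \<Longrightarrow> 0 < f n \<Longrightarrow> c * \<eta> ^ n \<le> f n"
    using supermultiplicative_lower_bound[OF nonneg super m(1) \<eta>(1)] by metis
  obtain N where N: "(1 / 2) ^ N < \<epsilon> * c / 2"
    using real_arch_pow_inv[of "\<epsilon> * c / 2" "1 / 2"] assms c(1) by auto
  \<comment> \<open>\<open>N * D\<close> gives \<open>N \<le> k\<close>, \<open>m\<close> allows the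
    lower bound for \<open>f\<close>, and \<open>h + 1\<close> allows \<open>b_le\<close>.\<close>
  have "b n \<le> \<epsilon> * f n" if n: "n \<ge> N * D + m + h + 1" for n
  proof (cases "f n = 0")
    case True
    then show ?thesis using b_le[of n 0] n by simp
  next
    case False
    then have "0 < f n" using nonneg[of n] by simp
    define k where "k = n div D"
    have "N \<le> k" unfolding k_def using n D by (subst less_eq_div_iff_mult_less_eq) auto
    have kD: "k * D \<le> n" unfolding k_def by simp
    have n_pos: "0 < n" using n by simp
    have "b n * (n / H) ^ k \<le> f (n + k * h) * fact k" by (rule b_le) (use n in simp)
    also have "\<dots> \<le> \<gamma> ^ (n + k * h) * real k ^ k"
      by (rule mult_mono) (use f_le n_pos fact_le_power_real \<gamma> in auto)
    also have "\<dots> \<le> \<gamma> ^ (n + k * h) * (n / D) ^ k"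
    proof -
      have "real k * real D \<le> real n" using kD by (metis of_nat_le_iff of_nat_mult)
      then have "real k \<le> n / D" using D by (simp add: pos_le_divide_eq)
      then show ?thesis using \<gamma> by (intro mult_left_mono power_mono) auto
    qed
    \<comment> \<open>The factor \<open>(n / H) ^ k\<close> is split off to cancel against the
      left-hand side.\<close>
    also have "\<dots> = \<gamma> ^ n * (\<gamma> ^ h * H / D) ^ k * (n / H) ^ k"
      using assms(6) by (simp add: power_add power_mult[symmetric] power_mult_distrib power_divide mult.commute)
    finally have "b n \<le> \<gamma> ^ n * (\<gamma> ^ h * H / D) ^ k"
      using n_pos assms(6) by (simp add: zero_less_power)
    also have "\<dots> \<le> \<gamma> ^ n * (1 / 4) ^ k"
      using D \<gamma> assms(6) by (intro mult_left_mono power_mono) (auto simp: divide_le_eq)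
    also have "\<gamma> ^ n = \<rho> ^ n * \<eta> ^ n"
      using \<rho>(1) by (simp add: \<eta>_def power_divide)
    also have "\<rho> ^ n = 2 ^ k * \<rho> ^ (n mod D)"
      unfolding k_def using \<rho>(2) by (metis div_mult_mod_eq mult.commute power_add power_mult)
    \<comment> \<open>The remainder of the division costs at most another factor
      \<open>\<rho> ^ D = 2\<close>.\<close>
    also have "\<rho> ^ (n mod D) \<le> \<rho> ^ D"
      using \<rho>(1) D by (intro power_increasing) (auto intro: less_imp_le)
    finally have "b n \<le> 2 ^ k * 2 * \<eta> ^ n * (1 / 4) ^ k"
      using \<rho>(2) \<eta>(1) by (simp add: mult_right_mono)
    also have "\<dots> = 2 * (1 / 2) ^ k * \<eta> ^ n"
    proof -
      have "(2::real) ^ k * (1 / 4) ^ k = (1 / 2) ^ k"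
        by (simp flip: power_mult_distrib)
      then show ?thesis by (simp add: mult_ac)
    qed
    also have "\<dots> \<le> \<epsilon> * c * \<eta> ^ n"
    proof -
      have "(1 / 2 :: real) ^ k \<le> (1 / 2) ^ N" using \<open>N \<le> k\<close> by (intro power_decreasing) auto
      then have "2 * (1 / 2) ^ k \<le> \<epsilon> * c" using N by linarith
      then show ?thesis using \<eta>(1) by (intro mult_right_mono) auto
    qed
    also have "\<dots> \<le> \<epsilon> * f n"
      using c(2)[of n] n \<open>0 < f n\<close> assms(7) by (simp add: mult.assoc)
    finally show ?thesis .
  qed
  then show ?thesis unfolding eventually_sequentially by blast
qed

section \<open>Counting graphs joined by a bridge\<close>

definition bridge_side :: "nat set \<Rightarrow> nat rel \<Rightarrow> nat set \<Rightarrow> bool" where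
  "bridge_side V E W \<longleftrightarrow> W \<subseteq> V \<and> cut_connected W (E \<inter> W \<times> W) \<and> (\<exists>a b. E \<inter> W \<times> (V - W) = {(a, b)})"

text \<open>If \<open>A\<close> and \<open>B\<close> met, connectedness of \<open>A\<close> would
  give an edge from \<open>A \<inter> B\<close> to \<open>A - B\<close>. It leaves \<open>B\<close>,
  so it is the bridge of \<open>B\<close>, which thus ends in \<open>A\<close>; likewise the bridge
  of \<open>A\<close> ends in \<open>B\<close>. Then no edge leaves \<open>A \<union> B\<close>,
  which must be all of \<open>V\<close>, too large for two overlapping sets of at most half the
  size.\<close>

lemma bridge_sides_disjoint:
  assumes "finite V" "sym E" "cut_connected V E"
    and A: "bridge_side V E A" and B: "bridge_side V E B"
    and card: "card A = card B" "2 * card A \<le> card V" and "A \<noteq> B"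
  shows "A \<inter> B = {}"
proof (rule ccontr)
  assume ne: "A \<inter> B \<noteq> {}"
  have fin: "finite A" "finite B"
    using A B assms(1) by (auto simp: bridge_side_def intro: finite_subset)
  have "\<not> A \<subseteq> B" "\<not> B \<subseteq> A"
    using card_subset_eq[OF fin(2), of A] card_subset_eq[OF fin(1), of B] card \<open>A \<noteq> B\<close> by auto
  obtain a b where ab: "E \<inter> A \<times> (V - A) = {(a, b)}" using A by (auto simp: bridge_side_def)
  obtain a' b' where ab': "E \<inter> B \<times> (V - B) = {(a', b')}" using B by (auto simp: bridge_side_def)
  have "\<exists>c\<in>A \<inter> B. \<exists>d\<in>A - A \<inter> B. (c, d) \<in> E"
  proof -
    have "cut_connected A (E \<inter> A \<times> A)" using A by (simp add: bridge_side_def)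
    then obtain c d where "c \<in> A \<inter> B" "d \<in> A - A \<inter> B" "(c, d) \<in> E \<inter> A \<times> A"
      unfolding cut_connected_def using ne \<open>\<not> A \<subseteq> B\<close> by (metis Int_lower1 inf.absorb_iff1)
    then show ?thesis by blast
  qed
  then obtain c d where "c \<in> A \<inter> B" "d \<in> A - A \<inter> B" "(c, d) \<in> E" by blast
  then have "(c, d) \<in> E \<inter> B \<times> (V - B)" using A by (auto simp: bridge_side_def)
  then have b': "b' \<in> A" using ab' \<open>d \<in> A - A \<inter> B\<close> by auto
  have "\<exists>c\<in>A \<inter> B. \<exists>d\<in>B - A \<inter> B. (c, d) \<in> E"
  proof -
    have "cut_connected B (E \<inter> B \<times> B)" using B by (simp add: bridge_side_def)
    then obtain c d where "c \<in> A \<inter> B" "d \<in> B - A \<inter> B" "(c, d) \<in> E \<inter> B \<times> B"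
      unfolding cut_connected_def using ne \<open>\<not> B \<subseteq> A\<close> by (metis Int_lower2 inf.absorb_iff2)
    then show ?thesis by blast
  qed
  then obtain c d where "c \<in> A \<inter> B" "d \<in> B - A \<inter> B" "(c, d) \<in> E" by blast
  then have "(c, d) \<in> E \<inter> A \<times> (V - A)" using B by (auto simp: bridge_side_def)
  then have b: "b \<in> B" using ab \<open>d \<in> B - A \<inter> B\<close> by auto
  have "A \<union> B = V"
  proof (rule ccontr)
    assume "A \<union> B \<noteq> V"
    moreover have "A \<union> B \<subseteq> V" "A \<union> B \<noteq> {}" using A B ne by (auto simp: bridge_side_def)
    ultimately obtain c d where "c \<in> A \<union> B" "d \<in> V - (A \<union> B)" "(c, d) \<in> E"
      using assms(3) unfolding cut_connected_def by meson
    then have "(c, d) \<in> E \<inter> A \<times> (V - A) \<or> (c, d) \<in> E \<inter> B \<times> (V - B)" by auto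
    then show False using ab ab' b b' \<open>d \<in> V - (A \<union> B)\<close> by auto
  qed
  then have "card V + card (A \<inter> B) = card A + card B" using card_Un_Int[OF fin] by simp
  moreover have "0 < card (A \<inter> B)" using ne fin by (simp add: card_gt_0_iff)
  ultimately show False using card by simp
qed

lemma bridge_Int:
  assumes "E \<subseteq> V \<times> V" "E' \<subseteq> V' \<times> V'" "V \<inter> V' = {}" "u \<in> V" "v \<in> V'"
  shows "bridge E E' u v \<inter> V \<times> V = E" "bridge E E' u v \<inter> V' \<times> V' = E'"
    "bridge E E' u v \<inter> V \<times> V' = {(u, v)}"
  using assms unfolding bridge_def by blast+

lemma map_prod_image_eq_iff:
  assumes "inj_on p V" "E \<subseteq> V \<times> V" "E' \<subseteq> V \<times> V"
  shows "map_prod p p ` E = map_prod p p ` E' \<longleftrightarrow> E = E'"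
  by (rule inj_on_image_eq_iff[OF map_prod_inj_on[OF assms(1,1)] assms(2,3)])

context bridge_class
begin

definition Kn :: "nat \<Rightarrow> nat rel set" where
  "Kn n = {E. K {1..n} E}"

lemma finite_Kn: "finite (Kn n)"
  by (rule finite_subset[of _ "Pow ({1..n} \<times> {1..n})"]) (auto simp: Kn_def dest: K_edges)

text \<open>Sides of size \<open>h\<close> are pairwise disjoint, so their least elements
  differ.\<close>

lemma card_bridge_sides_le:
  assumes "K V E" "2 * h \<le> card V"
  shows "card {W. bridge_side V E W \<and> card W = h} \<le> card V"
proof (rule card_inj_on_le[where f = Min])
  have fin: "finite W" "W \<noteq> {}" if "bridge_side V E W" for W
    using that K_finite[OF assms(1)] by (auto simp: bridge_side_def cut_connected_def intro: finite_subset)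
  show "inj_on Min {W. bridge_side V E W \<and> card W = h}"
  proof (rule inj_onI, rule ccontr)
    fix A B assume *: "A \<in> {W. bridge_side V E W \<and> card W = h}" "B \<in> {W. bridge_side V E W \<and> card W = h}"
      "Min A = Min B" "A \<noteq> B"
    then have "A \<inter> B = {}"
      using bridge_sides_disjoint[OF K_finite K_sym K_connected, OF assms(1) assms(1) assms(1), of A B] assms(2)
      by simp
    moreover have "Min A \<in> A" "Min B \<in> B" using * fin Min_in by blast+
    ultimately show False using *(3) by (metis disjoint_iff)
  qed
  show "Min ` {W. bridge_side V E W \<and> card W = h} \<subseteq> V"
    using fin Min_in unfolding bridge_side_def by blast
qed (rule K_finite[OF assms(1)])

text \<open>The side \<open>W\<close> is recorded with the graph so that the construction can be
  undone. The end of the bridge in the part from \<open>Z\<close> is fixed by \<open>x\<close>, the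
  end in the part from \<open>Y\<close> is free.\<close>

definition joined :: "nat \<Rightarrow> nat \<Rightarrow> nat rel set \<Rightarrow> nat rel set \<Rightarrow> nat \<Rightarrow> (nat rel \<times> nat set) set" where
  "joined n h Y Z x = {(E, W). W \<subseteq> {1..n + h} \<and> card W = h \<and>
     (\<exists>\<phi> \<psi> F D v. bij_betw \<phi> {1..h} W \<and> bij_betw \<psi> {1..n} ({1..n + h} - W) \<and> F \<in> Z \<and> D \<in> Y \<and> v \<in> {1..n} \<and>
        E = bridge (map_prod \<phi> \<phi> ` F) (map_prod \<psi> \<psi> ` D) (\<phi> x) (\<psi> v))}"

lemma joinedE:
  assumes "(E, W) \<in> joined n h Y Z x" "Y \<subseteq> Kn n" "Z \<subseteq> Kn h" "x \<in> {1..h}"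
  obtains \<phi> \<psi> F D v U where "W \<union> U = {1..n + h}" "W \<inter> U = {}" "U = {1..n + h} - W" "card W = h"
    "bij_betw \<phi> {1..h} W" "bij_betw \<psi> {1..n} U" "F \<in> Z" "D \<in> Y" "v \<in> {1..n}" "\<phi> x \<in> W" "\<psi> v \<in> U"
    "K W (map_prod \<phi> \<phi> ` F)" "K U (map_prod \<psi> \<psi> ` D)"
    "E = bridge (map_prod \<phi> \<phi> ` F) (map_prod \<psi> \<psi> ` D) (\<phi> x) (\<psi> v)" "E \<in> Kn (n + h)"
proof -
  obtain \<phi> \<psi> F D v where *: "W \<subseteq> {1..n + h}" "card W = h" "bij_betw \<phi> {1..h} W"
    "bij_betw \<psi> {1..n} ({1..n + h} - W)" "F \<in> Z" "D \<in> Y" "v \<in> {1..n}"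
    "E = bridge (map_prod \<phi> \<phi> ` F) (map_prod \<psi> \<psi> ` D) (\<phi> x) (\<psi> v)"
    using assms(1) unfolding joined_def by blast
  let ?U = "{1..n + h} - W"
  have eq: "W \<union> ?U = {1..n + h}" "W \<inter> ?U = {}" using *(1) by auto
  have mem: "\<phi> x \<in> W" "\<psi> v \<in> ?U" using *(3,4,7) assms(4) by (auto dest: bij_betwE)
  have "K {1..h} F" "K {1..n} D" using *(5,6) assms(2,3) by (auto simp: Kn_def)
  then have KW: "K W (map_prod \<phi> \<phi> ` F)" and KU: "K ?U (map_prod \<psi> \<psi> ` D)"
    using K_iso *(3,4) unfolding bij_betw_def by metis+
  have "K (W \<union> ?U) E" unfolding *(8) by (rule K_bridge[OF KW KU eq(2) mem])
  then have "E \<in> Kn (n + h)" unfolding eq Kn_def by simp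
  with * eq mem KW KU that[of ?U \<phi> \<psi> F D v] show ?thesis by blast
qed

lemma joined_subset:
  assumes "Y \<subseteq> Kn n" "Z \<subseteq> Kn h" "x \<in> {1..h}"
  shows "joined n h Y Z x \<subseteq> Kn (n + h) \<times> Pow {1..n + h}"
  using joinedE[OF _ assms] unfolding joined_def by blast

text \<open>Fix relabellings for every \<open>W\<close>. Cutting the marked graph along
  \<open>W\<close> returns both parts and the bridge, so different choices of \<open>W\<close>,
  \<open>D\<close>, \<open>F\<close> and \<open>v\<close> give different pairs.\<close>

lemma card_joined_ge:
  assumes "Y \<subseteq> Kn n" "Z \<subseteq> Kn h" "x \<in> {1..h}"
  shows "card Y * card Z * n * ((n + h) choose h) \<le> card (joined n h Y Z x)"
proof -
  let ?S = "{W. W \<subseteq> {1..n + h} \<and> card W = h}"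
  have "\<exists>\<phi>. bij_betw \<phi> {1..h} W" if "W \<in> ?S" for W
    using that by (intro finite_same_card_bij) (auto intro: finite_subset)
  then obtain \<phi> where \<phi>: "\<And>W. W \<in> ?S \<Longrightarrow> bij_betw (\<phi> W) {1..h} W" by metis
  have "\<exists>\<psi>. bij_betw \<psi> {1..n} ({1..n + h} - W)" if "W \<in> ?S" for W
  proof (rule finite_same_card_bij)
    have "finite W" using that by (auto intro: finite_subset)
    then show "card {1..n} = card ({1..n + h} - W)" using that by (simp add: card_Diff_subset)
  qed simp_all
  then obtain \<psi> where \<psi>: "\<And>W. W \<in> ?S \<Longrightarrow> bij_betw (\<psi> W) {1..n} ({1..n + h} - W)" by metis
  define J where "J = (\<lambda>(W, D, F, v). (bridge (map_prod (\<phi> W) (\<phi> W) ` F) (map_prod (\<psi> W) (\<psi> W) ` D) (\<phi> W x) (\<psi> W v), W))"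
  let ?T = "?S \<times> Y \<times> Z \<times> {1..n}"
  have "inj_on J ?T"
  proof (rule inj_onI)
    fix t t' assume t: "t \<in> ?T" "t' \<in> ?T" and eq: "J t = J t'"
    obtain W D F v where tt: "t = (W, D, F, v)" by (metis prod_cases4)
    obtain W' D' F' v' where tt': "t' = (W', D', F', v')" by (metis prod_cases4)
    have [simp]: "W' = W" using eq by (simp add: J_def tt tt')
    have W: "W \<in> ?S" and mem: "D \<in> Y" "D' \<in> Y" "F \<in> Z" "F' \<in> Z" "v \<in> {1..n}" "v' \<in> {1..n}"
      using t tt tt' by auto
    let ?U = "{1..n + h} - W"
    let ?\<phi> = "\<phi> W" and ?\<psi> = "\<psi> W"
    have sub: "D \<subseteq> {1..n} \<times> {1..n}" "D' \<subseteq> {1..n} \<times> {1..n}" "F \<subseteq> {1..h} \<times> {1..h}" "F' \<subseteq> {1..h} \<times> {1..h}"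
      using mem assms by (auto simp: Kn_def dest: K_edges)
    have im: "?\<phi> ` {1..h} = W" "?\<psi> ` {1..n} = ?U" and inj: "inj_on ?\<phi> {1..h}" "inj_on ?\<psi> {1..n}"
      using \<phi>[OF W] \<psi>[OF W] by (auto simp: bij_betw_def)
    have sub': "map_prod ?\<psi> ?\<psi> ` D \<subseteq> ?U \<times> ?U" "map_prod ?\<psi> ?\<psi> ` D' \<subseteq> ?U \<times> ?U"
      "map_prod ?\<phi> ?\<phi> ` F \<subseteq> W \<times> W" "map_prod ?\<phi> ?\<phi> ` F' \<subseteq> W \<times> W"
      using sub[THEN map_prod_image_subset] im by metis+
    have mem': "?\<phi> x \<in> W" "?\<psi> v \<in> ?U" "?\<psi> v' \<in> ?U" using mem assms(3) im by blast+
    have disj: "W \<inter> ?U = {}" by auto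
    have B: "bridge (map_prod ?\<phi> ?\<phi> ` F) (map_prod ?\<psi> ?\<psi> ` D) (?\<phi> x) (?\<psi> v) =
        bridge (map_prod ?\<phi> ?\<phi> ` F') (map_prod ?\<psi> ?\<psi> ` D') (?\<phi> x) (?\<psi> v')"
      using eq by (simp add: J_def tt tt')
    note 1 = bridge_Int[OF sub'(3,1) disj mem'(1,2)]
    note 2 = bridge_Int[OF sub'(4,2) disj mem'(1,3)]
    have "map_prod ?\<phi> ?\<phi> ` F = map_prod ?\<phi> ?\<phi> ` F'" using 1(1) 2(1) B by metis
    then have "F = F'" using map_prod_image_eq_iff[OF inj(1) sub(3,4)] by simp
    have "map_prod ?\<psi> ?\<psi> ` D = map_prod ?\<psi> ?\<psi> ` D'" using 1(2) 2(2) B by metis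
    then have "D = D'" using map_prod_image_eq_iff[OF inj(2) sub(1,2)] by simp
    have "{(?\<phi> x, ?\<psi> v)} = {(?\<phi> x, ?\<psi> v')}" using 1(3) 2(3) B by metis
    then have "v = v'" using inj(2) mem by (auto dest: inj_onD)
    with \<open>F = F'\<close> \<open>D = D'\<close> show "t = t'" by (simp add: tt tt')
  qed
  moreover have "J ` ?T \<subseteq> joined n h Y Z x"
  proof
    fix t assume "t \<in> J ` ?T"
    then obtain W D F v where t: "t = J (W, D, F, v)" and "W \<in> ?S" "D \<in> Y" "F \<in> Z" "v \<in> {1..n}" by auto
    then show "t \<in> joined n h Y Z x"
      unfolding t J_def joined_def prod.case mem_Collect_eq using \<phi>[of W] \<psi>[of W]
      by (intro conjI exI[of _ "\<phi> W"] exI[of _ "\<psi> W"] exI[of _ F] exI[of _ D] exI[of _ v]) auto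
  qed
  moreover have "finite (joined n h Y Z x)"
    by (rule finite_subset[OF joined_subset[OF assms]]) (simp add: finite_Kn)
  ultimately have "card ?T \<le> card (joined n h Y Z x)" by (rule card_inj_on_le)
  moreover have "card ?S = (n + h) choose h" using n_subsets[of "{1..n + h}" h] by simp
  ultimately show ?thesis by (simp add: card_cartesian_product mult_ac)
qed

lemma joined_bridge_side:
  assumes "(E, W) \<in> joined n h Y Z x" "Y \<subseteq> Kn n" "Z \<subseteq> Kn h" "x \<in> {1..h}"
  shows "bridge_side {1..n + h} E W" "card W = h"
proof -
  show "bridge_side {1..n + h} E W"
  proof (rule joinedE[OF assms])
    fix \<phi> \<psi> F D v U
    assume *: "W \<union> U = {1..n + h}" "W \<inter> U = {}" "U = {1..n + h} - W"
      "\<phi> x \<in> W" "\<psi> v \<in> U" "K W (map_prod \<phi> \<phi> ` F)" "K U (map_prod \<psi> \<psi> ` D)"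
      "E = bridge (map_prod \<phi> \<phi> ` F) (map_prod \<psi> \<psi> ` D) (\<phi> x) (\<psi> v)"
    note 1 = bridge_Int[OF K_edges K_edges *(2,4,5), OF *(6,7), folded *(8)]
    have "cut_connected W (E \<inter> W \<times> W)" unfolding 1 by (rule K_connected[OF *(6)])
    moreover have "E \<inter> W \<times> ({1..n + h} - W) = {(\<phi> x, \<psi> v)}" using 1(3) *(3) by simp
    moreover have "W \<subseteq> {1..n + h}" using *(1) by blast
    ultimately show ?thesis unfolding bridge_side_def by blast
  qed
qed (use assms in \<open>auto simp: joined_def\<close>)

text \<open>Double counting of marked graphs: one graph has at most \<open>n + h\<close> bridge
  sides of size \<open>h\<close>. The condition \<open>h \<le> n\<close> makes such a side at most
  half of the graph.\<close>

lemma card_Kn_super: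
  assumes "1 \<le> h" "h \<le> n"
  shows "card (Kn n) * card (Kn h) * n * ((n + h) choose h) \<le> card (Kn (n + h)) * (n + h)"
proof -
  have x: "1 \<in> {1..h}" using assms by simp
  have fin: "finite {W. bridge_side {1..n + h} E W \<and> card W = h}" for E
    by (rule finite_subset[of _ "Pow {1..n + h}"]) (auto simp: bridge_side_def)
  have "card (joined n h (Kn n) (Kn h) 1) \<le> card (Sigma (Kn (n + h)) (\<lambda>E. {W. bridge_side {1..n + h} E W \<and> card W = h}))"
  proof (rule card_mono)
    show "finite (Sigma (Kn (n + h)) (\<lambda>E. {W. bridge_side {1..n + h} E W \<and> card W = h}))"
      by (intro finite_SigmaI finite_Kn fin)
    show "joined n h (Kn n) (Kn h) 1 \<subseteq> Sigma (Kn (n + h)) (\<lambda>E. {W. bridge_side {1..n + h} E W \<and> card W = h})"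
      using joined_bridge_side[OF _ order_refl order_refl x] joined_subset[OF order_refl order_refl x] by fastforce
  qed
  also have "\<dots> = (\<Sum>E\<in>Kn (n + h). card {W. bridge_side {1..n + h} E W \<and> card W = h})"
    by (rule card_SigmaI) (use finite_Kn fin in auto)
  also have "\<dots> \<le> (\<Sum>E\<in>Kn (n + h). n + h)"
    by (rule sum_mono) (use card_bridge_sides_le[of "{1..n + h}" _ h] assms in \<open>auto simp: Kn_def\<close>)
  finally show ?thesis using card_joined_ge[OF order_refl order_refl x, where n = n] by simp
qed

end

section \<open>Pendant copies of a fixed graph\<close>

lemma map_prod_image_Int_Times:
  assumes "inj_on p V" "E \<subseteq> V \<times> V" "A \<subseteq> V" "B \<subseteq> V"
  shows "map_prod p p ` E \<inter> p ` A \<times> p ` B = map_prod p p ` (E \<inter> A \<times> B)"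
proof -
  have "p ` A \<times> p ` B = map_prod p p ` (A \<times> B)" by force
  moreover have "map_prod p p ` (E \<inter> A \<times> B) = map_prod p p ` E \<inter> map_prod p p ` (A \<times> B)"
    by (rule inj_on_image_Int[OF map_prod_inj_on[OF assms(1,1)] assms(2)]) (use assms in blast)
  ultimately show ?thesis by simp
qed

text \<open>The graph that remains when a pendant copy is deleted need not belong to the class.\<close>

definition pendant :: "nat \<Rightarrow> nat rel \<Rightarrow> nat \<Rightarrow> nat set \<Rightarrow> nat rel \<Rightarrow> nat set \<Rightarrow> bool" where
  "pendant h M x V E W \<longleftrightarrow> W \<subseteq> V \<and>
     (\<exists>\<phi> b. bij_betw \<phi> {1..h} W \<and> E \<inter> W \<times> W = map_prod \<phi> \<phi> ` M \<and> E \<inter> W \<times> (V - W) = {(\<phi> x, b)})"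

lemma pendantE:
  assumes "pendant h M x V E W"
  obtains \<phi> b where "W \<subseteq> V" "bij_betw \<phi> {1..h} W" "E \<inter> W \<times> W = map_prod \<phi> \<phi> ` M"
    "E \<inter> W \<times> (V - W) = {(\<phi> x, b)}"
  using assms unfolding pendant_def by blast

lemma pendant_image:
  assumes "inj_on p V" "E \<subseteq> V \<times> V" "pendant h M x V E W"
  shows "pendant h M x (p ` V) (map_prod p p ` E) (p ` W)"
proof -
  obtain \<phi> b where *: "W \<subseteq> V" "bij_betw \<phi> {1..h} W" "E \<inter> W \<times> W = map_prod \<phi> \<phi> ` M"
    "E \<inter> W \<times> (V - W) = {(\<phi> x, b)}"
    by (rule pendantE[OF assms(3)])
  have "bij_betw p W (p ` W)" using assms(1) *(1) by (auto simp: bij_betw_def intro: inj_on_subset)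
  with *(2) have "bij_betw (p \<circ> \<phi>) {1..h} (p ` W)" by (rule bij_betw_trans)
  moreover have "map_prod p p ` E \<inter> p ` W \<times> p ` W = map_prod (p \<circ> \<phi>) (p \<circ> \<phi>) ` M"
    unfolding map_prod_image_Int_Times[OF assms(1,2) *(1,1)] *(3) image_comp
    by (simp add: map_prod_compose)
  moreover have "map_prod p p ` E \<inter> p ` W \<times> (p ` V - p ` W) = {((p \<circ> \<phi>) x, p b)}"
    unfolding inj_on_image_set_diff[OF assms(1) Diff_subset *(1), symmetric]
      map_prod_image_Int_Times[OF assms(1,2) *(1) Diff_subset] *(4) by simp
  ultimately show ?thesis unfolding pendant_def using *(1) by blast
qed

lemma finite_pendants: "finite V \<Longrightarrow> finite {W. pendant h M x V E W}"
  by (rule finite_subset[of _ "Pow V"]) (auto simp: pendant_def)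

lemma card_pendants_image_le:
  assumes "inj_on p V" "E \<subseteq> V \<times> V" "finite V"
  shows "card {W. pendant h M x (p ` V) (map_prod p p ` E) W} \<le> card {W. pendant h M x V E W}"
proof -
  let ?q = "inv_into V p"
  have inj: "inj_on ?q (p ` V)" by (rule inj_on_inv_into) simp
  have V: "?q ` p ` V = V" using assms(1) by simp
  have "map_prod ?q ?q ` map_prod p p ` E = (\<lambda>e. e) ` E"
    unfolding image_image by (rule image_cong) (use assms in \<open>auto simp: inv_into_f_f\<close>)
  then have E: "map_prod ?q ?q ` map_prod p p ` E = E" by simp
  show ?thesis
  proof (rule card_inj_on_le)
    show "inj_on ((`) ?q) {W. pendant h M x (p ` V) (map_prod p p ` E) W}"
      by (rule inj_on_subset[OF inj_on_image_Pow[OF inj]]) (auto simp: pendant_def)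
    show "(`) ?q ` {W. pendant h M x (p ` V) (map_prod p p ` E) W} \<subseteq> {W. pendant h M x V E W}"
      using pendant_image[OF inj map_prod_image_subset[OF assms(2)]] unfolding V E by blast
  qed (rule finite_pendants[OF assms(3)])
qed

context bridge_class
begin

lemma pendant_bridge_side:
  assumes "K {1..h} M" "pendant h M x V E W"
  shows "bridge_side V E W" "card W = h"
proof -
  obtain \<phi> b where *: "W \<subseteq> V" "bij_betw \<phi> {1..h} W" "E \<inter> W \<times> W = map_prod \<phi> \<phi> ` M"
    "E \<inter> W \<times> (V - W) = {(\<phi> x, b)}"
    by (rule pendantE[OF assms(2)])
  have "K W (map_prod \<phi> \<phi> ` M)" using K_iso[OF assms(1), of \<phi>] *(2) by (simp add: bij_betw_def)
  then have "cut_connected W (E \<inter> W \<times> W)" unfolding *(3) by (rule K_connected)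
  then show "bridge_side V E W" unfolding bridge_side_def using * by blast
  show "card W = h" using bij_betw_same_card[OF *(2)] by simp
qed

text \<open>A pendant copy other than \<open>W\<close> is disjoint from \<open>W\<close>, as both
  are bridge sides, so it lies in \<open>U\<close>. Some edge leaves it inside \<open>U\<close>,
  because \<open>U\<close> is connected and larger; this is its only leaving edge, so it is pendant
  in \<open>U\<close> already.\<close>

lemma pendants_bridge:
  assumes M: "K {1..h} M" and KW: "K W F" and KU: "K U D" and disj: "W \<inter> U = {}" and mem: "a \<in> W" "v \<in> U"
    and card: "card W = h" "h < card U"
    and pend: "pendant h M x (W \<union> U) (bridge F D a v) W'"
  shows "W' = W \<or> pendant h M x U D W'"
proof (cases "W' = W")
  case False
  let ?V = "W \<union> U" and ?E = "bridge F D a v"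
  note Int = bridge_Int[OF K_edges[OF KW] K_edges[OF KU] disj mem]
  have KV: "K ?V ?E" by (rule K_bridge[OF KW KU disj mem])
  have VW: "?V - W = U" using disj by auto
  have "cut_connected W (?E \<inter> W \<times> W)" unfolding Int by (rule K_connected[OF KW])
  then have side: "bridge_side ?V ?E W"
    unfolding bridge_side_def VW Int by auto
  have side': "bridge_side ?V ?E W'" "card W' = h" by (rule pendant_bridge_side[OF M pend])+
  have "2 * h \<le> card ?V"
    using card disj K_finite[OF KW] K_finite[OF KU] by (simp add: card_Un_disjoint)
  then have "W' \<inter> W = {}"
    using bridge_sides_disjoint[OF K_finite[OF KV] K_sym[OF KV] K_connected[OF KV] side'(1) side] side'(2) card False
    by simp
  moreover have "W' \<subseteq> ?V" using side' by (simp add: bridge_side_def)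
  ultimately have sub: "W' \<subseteq> U" by auto
  obtain \<phi> b where *: "bij_betw \<phi> {1..h} W'" "?E \<inter> W' \<times> W' = map_prod \<phi> \<phi> ` M"
    "?E \<inter> W' \<times> (?V - W') = {(\<phi> x, b)}"
    using pend unfolding pendant_def by blast
  have E: "?E \<inter> U \<times> U = D" by (rule Int)
  have 1: "D \<inter> W' \<times> W' = map_prod \<phi> \<phi> ` M" unfolding *(2)[symmetric] using E sub by blast
  have 2: "D \<inter> W' \<times> (U - W') \<subseteq> {(\<phi> x, b)}" unfolding *(3)[symmetric] using E by blast
  have "W' \<noteq> {}" using side' by (auto simp: bridge_side_def cut_connected_def)
  moreover have "W' \<noteq> U" using side'(2) card by auto
  ultimately have "D \<inter> W' \<times> (U - W') \<noteq> {}"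
    using K_connected[OF KU] sub unfolding cut_connected_def by blast
  with 2 have "D \<inter> W' \<times> (U - W') = {(\<phi> x, b)}" by blast
  then show ?thesis unfolding pendant_def using sub *(1) 1 by blast
qed simp

definition few_pendants :: "nat \<Rightarrow> nat rel \<Rightarrow> nat \<Rightarrow> nat \<Rightarrow> nat \<Rightarrow> nat rel set" where
  "few_pendants h M x n j = {E \<in> Kn n. card {W. pendant h M x {1..n} E W} \<le> j}"

text \<open>Double counting as for all members, but the marked side is now one of at most
  \<open>Suc j\<close> pendant copies, which replaces the factor \<open>n + h\<close> by
  \<open>Suc j\<close>. One attachment adds at most one pendant copy.\<close>

lemma card_few_pendants_step:
  assumes M: "M \<in> Kn h" and x: "x \<in> {1..h}" and "h < n"
  shows "card (few_pendants h M x n j) * n * ((n + h) choose h) \<le> card (few_pendants h M x (n + h) (Suc j)) * Suc j"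
proof -
  let ?Y = "few_pendants h M x n j" and ?Y' = "few_pendants h M x (n + h) (Suc j)"
  let ?P = "\<lambda>E. {W. pendant h M x {1..n + h} E W}"
  have KM: "K {1..h} M" using M by (simp add: Kn_def)
  have Y: "?Y \<subseteq> Kn n" and Z: "{M} \<subseteq> Kn h" using M by (auto simp: few_pendants_def)
  have "(E, W) \<in> Sigma ?Y' ?P" if "(E, W) \<in> joined n h ?Y {M} x" for E W
  proof (rule joinedE[OF that Y Z x])
    fix \<phi> \<psi> F D v U
    assume *: "W \<union> U = {1..n + h}" "W \<inter> U = {}" "U = {1..n + h} - W" "card W = h"
      "bij_betw \<phi> {1..h} W" "bij_betw \<psi> {1..n} U" "F \<in> {M}" "D \<in> ?Y" "\<phi> x \<in> W" "\<psi> v \<in> U"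
      "K W (map_prod \<phi> \<phi> ` F)" "K U (map_prod \<psi> \<psi> ` D)"
      "E = bridge (map_prod \<phi> \<phi> ` F) (map_prod \<psi> \<psi> ` D) (\<phi> x) (\<psi> v)" "E \<in> Kn (n + h)"
    note Int = bridge_Int[OF K_edges[OF *(11)] K_edges[OF *(12)] *(2,9,10), folded *(13)]
    have "W \<in> ?P E"
      unfolding pendant_def mem_Collect_eq *(3)[symmetric] Int using *(1,5,7) by auto
    have inj: "inj_on \<psi> {1..n}" and im: "\<psi> ` {1..n} = U" using *(6) by (auto simp: bij_betw_def)
    have cardU: "card U = n" using bij_betw_same_card[OF *(6)] by simp
    have D: "D \<subseteq> {1..n} \<times> {1..n}" "card {W. pendant h M x {1..n} D W} \<le> j"
      using *(8) by (auto simp: few_pendants_def Kn_def dest: K_edges)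
    have le: "card {W. pendant h M x U (map_prod \<psi> \<psi> ` D) W} \<le> j"
      using card_pendants_image_le[OF inj D(1), of h M x] D(2) unfolding im by simp
    have finU: "finite U" by (rule K_finite[OF *(12)])
    have "?P E \<subseteq> insert W {W. pendant h M x U (map_prod \<psi> \<psi> ` D) W}"
      using pendants_bridge[OF KM *(11,12,2,9,10,4), of x] cardU \<open>h < n\<close> unfolding *(1) *(13)[symmetric] by auto
    then have "card (?P E) \<le> card (insert W {W. pendant h M x U (map_prod \<psi> \<psi> ` D) W})"
      by (intro card_mono) (simp_all add: finite_pendants[OF finU])
    also have "\<dots> \<le> Suc j"
      using le by (simp add: card_insert_if finite_pendants[OF finU])
    finally have "E \<in> ?Y'" using *(14) by (simp add: few_pendants_def)
    with \<open>W \<in> ?P E\<close> show ?thesis by simp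
  qed
  then have sub: "joined n h ?Y {M} x \<subseteq> Sigma ?Y' ?P" by auto
  have fin: "finite ?Y'" by (rule finite_subset[OF _ finite_Kn]) (auto simp: few_pendants_def)
  have "card ?Y * n * ((n + h) choose h) \<le> card (joined n h ?Y {M} x)"
    using card_joined_ge[OF Y Z x] by simp
  also have "\<dots> \<le> card (Sigma ?Y' ?P)"
    by (rule card_mono[OF _ sub]) (intro finite_SigmaI fin finite_pendants finite_atLeastAtMost)
  also have "\<dots> = (\<Sum>E\<in>?Y'. card (?P E))"
    by (rule card_SigmaI) (use fin finite_pendants in auto)
  also have "\<dots> \<le> (\<Sum>E\<in>?Y'. Suc j)" by (rule sum_mono) (simp add: few_pendants_def)
  finally show ?thesis by simp
qed

lemma few_pendants_step_real:
  assumes "M \<in> Kn h" "x \<in> {1..h}" "h < n"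
  shows "card (few_pendants h M x n j) / fact n * (n / fact h) \<le>
    card (few_pendants h M x (n + h) (Suc j)) / fact (n + h) * Suc j"
proof -
  have "real (card (few_pendants h M x n j) * n * ((n + h) choose h)) \<le>
      real (card (few_pendants h M x (n + h) (Suc j)) * Suc j)"
    using card_few_pendants_step[OF assms] by (rule of_nat_mono)
  then have "real (card (few_pendants h M x n j)) * n * ((n + h) choose h) / fact (n + h) \<le>
      real (card (few_pendants h M x (n + h) (Suc j))) * Suc j / fact (n + h)"
    by (intro divide_right_mono) (simp_all add: algebra_simps)
  then show ?thesis by (simp add: binomial_fact mult.commute)
qed

text \<open>The factors \<open>Suc j\<close> build up \<open>fact k\<close>, while the growing
  factors \<open>n + k * h\<close> are bounded below by \<open>n\<close>.\<close>

lemma few_pendants_iterate: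
  assumes "M \<in> Kn h" "x \<in> {1..h}" "h < n"
  shows "card (few_pendants h M x n 0) / fact n * (n / fact h) ^ k \<le>
    card (few_pendants h M x (n + k * h) k) / fact (n + k * h) * fact k"
proof (induction k)
  case (Suc k)
  let ?b = "\<lambda>n j. card (few_pendants h M x n j) / fact n"
  have "?b n 0 * (n / fact h) ^ Suc k = ?b n 0 * (n / fact h) ^ k * (n / fact h)" by simp
  also have "\<dots> \<le> ?b (n + k * h) k * fact k * ((n + k * h) / fact h)"
    by (rule mult_mono) (use Suc in \<open>auto simp: divide_right_mono\<close>)
  also have "\<dots> = ?b (n + k * h) k * ((n + k * h) / fact h) * fact k" by simp
  also have "\<dots> \<le> ?b (n + k * h + h) (Suc k) * Suc k * fact k"
    by (rule mult_right_mono[OF few_pendants_step_real[OF assms(1,2)]]) (use assms in auto)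
  finally show ?case by (simp add: algebra_simps)
qed simp

lemma no_pendant_negligible:
  fixes \<epsilon> :: real
  assumes small: "\<And>n. real (card (Kn n)) \<le> d ^ n * fact n" and "0 < d"
    and M: "M \<in> Kn h" "x \<in> {1..h}" and "0 < \<epsilon>"
  shows "eventually (\<lambda>n. real (card (few_pendants h M x n 0)) \<le> \<epsilon> * card (Kn n)) sequentially"
proof -
  \<comment> \<open>Halving absorbs the factor \<open>(n + m) / n \<le> 2\<close> and makes
    \<open>f\<close> supermultiplicative.\<close>
  define f where "f n = card (Kn n) / fact n / 2" for n
  define b where "b n = card (few_pendants h M x n 0) / fact n / 2" for n
  have "eventually (\<lambda>n. b n \<le> \<epsilon> * f n) sequentially"
  proof (rule exceptional_negligible)
    show "0 \<le> f n" for n by (simp add: f_def)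
    show "f n \<le> d ^ n" for n
    proof -
      have half: "c / 2 \<le> c" if "0 \<le> c" for c :: real using that by simp
      have "f n \<le> card (Kn n) / fact n" unfolding f_def by (rule half) simp
      also have "\<dots> \<le> d ^ n" using small[of n] by (simp add: divide_le_eq)
      finally show ?thesis .
    qed
    show "f n * f m \<le> f (n + m)" if "1 \<le> m" "m \<le> n" for n m
    proof -
      have "real (card (Kn n) * card (Kn m) * n * ((n + m) choose m)) \<le> real (card (Kn (n + m)) * (n + m))"
        using card_Kn_super[OF that] by (rule of_nat_mono)
      then have "real (card (Kn n)) * card (Kn m) * n * ((n + m) choose m) / fact (n + m) \<le>
          real (card (Kn (n + m))) * (n + m) / fact (n + m)"
        by (intro divide_right_mono) simp_all
      then have "card (Kn n) / fact n * (card (Kn m) / fact m) * n \<le> card (Kn (n + m)) / fact (n + m) * (n + m)"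
        by (simp add: binomial_fact mult.commute)
      also have "\<dots> \<le> card (Kn (n + m)) / fact (n + m) * (2 * n)"
        by (rule mult_left_mono) (use that in auto)
      finally have "card (Kn n) / fact n * (card (Kn m) / fact m) \<le> card (Kn (n + m)) / fact (n + m) * 2"
        using that by (simp add: field_simps)
      moreover have "a / 2 * (b / 2) \<le> c / 2" if "a * b \<le> c * 2" for a b c :: real using that by simp
      ultimately show ?thesis unfolding f_def by blast
    qed
    show "b n * (n / fact h) ^ k \<le> f (n + k * h) * fact k" if "h < n" for n k
    proof -
      have "card (few_pendants h M x (n + k * h) k) \<le> card (Kn (n + k * h))"
        by (rule card_mono[OF finite_Kn]) (auto simp: few_pendants_def)
      then have "card (few_pendants h M x (n + k * h) k) / fact (n + k * h) * fact k \<le>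
          card (Kn (n + k * h)) / fact (n + k * h) * fact k"
        by (intro mult_right_mono divide_right_mono) auto
      with few_pendants_iterate[OF M that, of k]
      have "card (few_pendants h M x n 0) / fact n * (n / fact h) ^ k \<le>
          card (Kn (n + k * h)) / fact (n + k * h) * fact k"
        by (rule order_trans)
      moreover have "a / 2 * t \<le> b / 2 * c" if "a * t \<le> b * c" for a b c t :: real using that by simp
      ultimately show ?thesis unfolding b_def f_def by blast
    qed
  qed (use assms in auto)
  then show ?thesis
    by eventually_elim (simp add: b_def f_def field_simps)
qed

section \<open>The zero-one law for bridge-closed classes\<close>

text \<open>Members with a pendant copy of the absorbing graph share a type at some root, hence
  agree on \<open>\<phi>\<close>; the others are negligible.\<close>

lemma zero_one:
  assumes "\<And>n. real (card (Kn n)) \<le> d ^ n * fact n" "0 < d" "mso_sentence \<phi>"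
  obtains \<beta> where "\<And>\<epsilon> :: real. 0 < \<epsilon> \<Longrightarrow> eventually (\<lambda>n.
    real (card {E \<in> Kn n. models \<lparr>pverts = {1..n}, parcs = E\<rparr> \<phi> \<noteq> \<beta>}) \<le> \<epsilon> * card (Kn n)) sequentially"
proof (cases "\<exists>V E. K V E")
  case False
  then show ?thesis using that by (simp add: Kn_def)
next
  case True
  define k q where "k = 2 * var_bound \<phi>" and "q = qrank \<phi>"
  from True obtain V0 E0 where K0: "K V0 E0" by auto
  obtain V M0 x0 \<nu> where M0: "K V M0" "x0 \<in> V"
    and absorb: "absorbing k q V M0 x0 \<nu>"
    using absorbing_graph[OF K0, of k q] .
  define h where "h = card V"
  have "card V = card {1..h}" by (simp add: h_def)
  from finite_same_card_bij[OF K_finite[OF M0(1)] finite_atLeastAtMost this]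
  obtain p where p: "bij_betw p V {1..h}" ..
  have inj_p: "inj_on p V" and im_p: "p ` V = {1..h}" using p by (auto simp: bij_betw_def)
  let ?M = "map_prod p p ` M0" and ?x = "p x0"
  have M: "?M \<in> Kn h" using K_iso[OF M0(1) inj_p] im_p by (simp add: Kn_def)
  have x: "?x \<in> {1..h}" using M0(2) im_p by blast
  have ty: "\<exists>y. ty k q (rooted {1..n} E y) = \<nu>" if E: "E \<in> Kn n" and pend: "pendant h ?M ?x {1..n} E W" for n E W
  proof -
    have KE: "K {1..n} E" using E by (simp add: Kn_def)
    obtain \<psi> b where *: "W \<subseteq> {1..n}" "bij_betw \<psi> {1..h} W" "E \<inter> W \<times> W = map_prod \<psi> \<psi> ` ?M"
      "E \<inter> W \<times> ({1..n} - W) = {(\<psi> ?x, b)}"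
      by (rule pendantE[OF pend])
    let ?\<phi> = "\<psi> \<circ> p" and ?U = "{1..n} - W"
    let ?D = "E \<inter> ?U \<times> ?U"
    have bij: "bij_betw ?\<phi> V W" using p *(2) by (rule bij_betw_trans)
    have im: "?\<phi> ` V = W" and inj: "inj_on ?\<phi> V" using bij by (auto simp: bij_betw_def)
    have b: "b \<in> ?U" using *(4) by blast
    have F: "E \<inter> W \<times> W = map_prod ?\<phi> ?\<phi> ` M0"
      unfolding *(3) image_comp by (simp add: map_prod_compose)
    \<comment> \<open>By symmetry the bridge is also the only edge in the other direction, so
      \<open>E\<close> splits into the copy, the rest \<open>?D\<close> and the bridge.\<close>
    have "E \<inter> ?U \<times> W = (E\<inverse> \<inter> ?U \<times> W)"
      using K_sym[OF KE] by (simp add: sym_conv_converse_eq)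
    then have "E \<inter> ?U \<times> W = (E \<inter> W \<times> ?U)\<inverse>" by blast
    then have "E \<inter> ?U \<times> W = {(b, ?\<phi> x0)}" unfolding *(4) by auto
    moreover have "E = E \<inter> W \<times> W \<union> ?D \<union> E \<inter> W \<times> ?U \<union> E \<inter> ?U \<times> W"
      using K_edges[OF KE] by blast
    ultimately have E_eq: "E = bridge (map_prod ?\<phi> ?\<phi> ` M0) ?D (?\<phi> x0) b"
      unfolding bridge_def F *(4) by auto
    have V_eq: "{1..n} = ?\<phi> ` V \<union> ?U" unfolding im using *(1) by auto
    have "\<exists>y. ty k q (rooted (?\<phi> ` V \<union> ?U) (bridge (map_prod ?\<phi> ?\<phi> ` M0) ?D (?\<phi> x0) b) y) = \<nu>"
    proof (rule absorb[unfolded absorbing_def, rule_format, OF inj])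
      show "K (?\<phi> ` V \<union> ?U) (bridge (map_prod ?\<phi> ?\<phi> ` M0) ?D (?\<phi> x0) b)"
        unfolding V_eq[symmetric] E_eq[symmetric] by (rule KE)
    qed (use im b in auto)
    then show ?thesis unfolding V_eq[symmetric] E_eq[symmetric] .
  qed
  \<comment> \<open>\<open>\<beta>\<close> is the common truth value on the graphs of type
    \<open>\<nu>\<close>, and \<open>False\<close> by default if there are none.\<close>
  define \<beta> where "\<beta> \<longleftrightarrow> (\<exists>n E y. ty k q (rooted {1..n} E y) = \<nu> \<and> models \<lparr>pverts = {1..n}, parcs = E\<rparr> \<phi>)"
  have \<beta>: "models \<lparr>pverts = {1..n}, parcs = E\<rparr> \<phi> \<longleftrightarrow> \<beta>" if "ty k q (rooted {1..n} E y) = \<nu>" for n E y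
  proof -
    have "models \<lparr>pverts = {1..n}, parcs = E\<rparr> \<phi> \<longleftrightarrow> models \<lparr>pverts = {1..n'}, parcs = E'\<rparr> \<phi>"
      if "ty k q (rooted {1..n'} E' y') = \<nu>" for n' E' y'
      unfolding models_def
      by (rule sat_eq_if_ty_eq[where q = q and b = "var_bound \<phi>" and r = y and r' = y' and B = "\<lambda>_. {}" and B' = "\<lambda>_. {}"])
        (use that \<open>ty k q (rooted {1..n} E y) = \<nu>\<close> assms(3) in \<open>auto simp: k_def q_def encodes_def mso_sentence_def\<close>)
    then show ?thesis unfolding \<beta>_def using that by metis
  qed
  show ?thesis
  proof (rule that)
    fix \<epsilon> :: real assume "0 < \<epsilon>"
    have "{E \<in> Kn n. models \<lparr>pverts = {1..n}, parcs = E\<rparr> \<phi> \<noteq> \<beta>} \<subseteq> few_pendants h ?M ?x n 0" for n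
      using ty \<beta> finite_pendants[of "{1..n}" h ?M ?x] by (fastforce simp: few_pendants_def)
    then have le: "card {E \<in> Kn n. models \<lparr>pverts = {1..n}, parcs = E\<rparr> \<phi> \<noteq> \<beta>} \<le> card (few_pendants h ?M ?x n 0)" for n
      by (intro card_mono finite_subset[OF _ finite_Kn[of n]]) (auto simp: few_pendants_def)
    show "eventually (\<lambda>n. real (card {E \<in> Kn n. models \<lparr>pverts = {1..n}, parcs = E\<rparr> \<phi> \<noteq> \<beta>}) \<le> \<epsilon> * card (Kn n)) sequentially"
      using no_pendant_negligible[OF assms(1,2) M x \<open>0 < \<epsilon>\<close>]
      by eventually_elim (rule order_trans[OF of_nat_mono[OF le]])
  qed
qed

end

section \<open>Addable classes\<close>

lemma pair_graph_iff:
  "pair_graph G \<longleftrightarrow> finite (pverts G) \<and> parcs G \<subseteq> pverts G \<times> pverts G \<and> sym (parcs G) \<and> irrefl (parcs G)"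
proof
  assume "pair_graph G"
  then interpret pair_graph G .
  show "finite (pverts G) \<and> parcs G \<subseteq> pverts G \<times> pverts G \<and> sym (parcs G) \<and> irrefl (parcs G)"
    using pair_finite_verts pair_sym_arcs pair_no_loops[of "(a, a)" for a] wellformed'
    by (auto simp: symmetric_def irrefl_def)
next
  assume G: "finite (pverts G) \<and> parcs G \<subseteq> pverts G \<times> pverts G \<and> sym (parcs G) \<and> irrefl (parcs G)"
  then have "finite (parcs G)" by (meson finite_SigmaI finite_subset)
  with G show "pair_graph G"
    by unfold_locales (auto simp: symmetric_def irrefl_def)
qed

text \<open>The set reachable from \<open>u\<close> has no leaving edge, so it is everything;
  conversely, a path out of \<open>S\<close> crosses the cut at some edge.\<close>

lemma cut_connected_iff_rtrancl_on:
  "cut_connected V E \<longleftrightarrow> V \<noteq> {} \<and> (\<forall>u\<in>V. \<forall>v\<in>V. (u, v) \<in> rtrancl_on V E)"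
proof (intro iffI conjI ballI)
  assume cut: "cut_connected V E"
  then show "V \<noteq> {}" by (simp add: cut_connected_def)
  fix u v assume uv: "u \<in> V" "v \<in> V"
  let ?S = "{w \<in> V. (u, w) \<in> rtrancl_on V E}"
  have "?S = V"
  proof (rule ccontr)
    assume "?S \<noteq> V"
    moreover have "u \<in> ?S" using uv by simp
    ultimately obtain a b where "a \<in> ?S" "b \<in> V - ?S" "(a, b) \<in> E"
      using cut unfolding cut_connected_def by (metis (no_types, lifting) empty_iff mem_Collect_eq subsetI)
    then show False by (auto intro: rtrancl_on_into_rtrancl_on)
  qed
  then show "(u, v) \<in> rtrancl_on V E" using uv by auto
next
  assume conn: "V \<noteq> {} \<and> (\<forall>u\<in>V. \<forall>v\<in>V. (u, v) \<in> rtrancl_on V E)"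
  have cross: "\<exists>a\<in>S. \<exists>b\<in>V - S. (a, b) \<in> E"
    if "(u, v) \<in> rtrancl_on V E" "u \<in> S" "v \<notin> S" for u v S
    using that by (induction rule: rtrancl_on_induct) blast+
  show "cut_connected V E" unfolding cut_connected_def
  proof (intro conjI allI impI)
    fix S assume S: "S \<subseteq> V" "S \<noteq> {}" "S \<noteq> V"
    then obtain u v where "u \<in> S" "v \<in> V - S" by blast
    then show "\<exists>a\<in>S. \<exists>b\<in>V - S. (a, b) \<in> E" using cross conn S by blast
  qed (use conn in simp)
qed

lemma connected_with_proj_iff:
  "Digraph_Component.connected (with_proj G) \<longleftrightarrow> cut_connected (pverts G) (parcs G \<union> (parcs G)\<inverse>)"
proof -
  have "mk_symmetric (with_proj G) = \<lparr>pverts = pverts G, parcs = parcs G \<union> (parcs G)\<inverse>\<rparr>"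
    by (auto simp: mk_symmetric_def)
  then show ?thesis
    unfolding connected_def strongly_connected_def reachable_def cut_connected_iff_rtrancl_on by simp
qed

lemma sym_Un_converse: "sym E \<Longrightarrow> E \<union> E\<inverse> = E"
  by (auto dest: symD)

lemma in_Conn_iff: "G \<in> Conn \<longleftrightarrow> pair_graph G \<and> cut_connected (pverts G) (parcs G)"
  by (auto simp: Conn_def connected_with_proj_iff pair_graph_iff sym_Un_converse)

lemma subgraph_with_proj_iff:
  "subgraph (with_proj H) (with_proj G) \<longleftrightarrow> pverts H \<subseteq> pverts G \<and> parcs H \<subseteq> parcs G \<and>
     pair_wf_digraph G \<and> pair_wf_digraph H"
  by (auto simp: subgraph_def wf_digraph_wp_iff)

lemma subgraph_with_projE:
  assumes "subgraph H (with_proj G)"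
  obtains H' where "H = with_proj H'"
proof
  show "H = with_proj \<lparr>pverts = verts H, parcs = arcs H\<rparr>"
    using assms by (simp add: subgraph_def compatible_def with_proj_def)
qed

lemma with_proj_inject: "with_proj G = with_proj H \<longleftrightarrow> G = H"
  by (auto simp: with_proj_def)

text \<open>Maximality ranges over all digraphs, but every subgraph of \<open>with_proj G\<close> is
  itself of the form \<open>with_proj H'\<close>.\<close>

lemma mem_components_iff:
  "H \<in> components G \<longleftrightarrow> subgraph (with_proj H) (with_proj G) \<and> Digraph_Component.connected (with_proj H) \<and>
     (\<forall>H'. H' \<noteq> H \<longrightarrow> subgraph (with_proj H) (with_proj H') \<longrightarrow> subgraph (with_proj H') (with_proj G) \<longrightarrow>
       \<not> Digraph_Component.connected (with_proj H'))"
  unfolding components_def pre_digraph.max_subgraph_def mem_Collect_eq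
  by (metis subgraph_with_projE with_proj_inject)

lemma connected_subgraph_of_disjoint_union:
  fixes V V' :: "nat set"
  assumes disj: "V \<inter> V' = {}" and E: "E \<subseteq> V \<times> V" "E' \<subseteq> V' \<times> V'"
    and H: "subgraph (with_proj H) (with_proj \<lparr>pverts = V \<union> V', parcs = E \<union> E'\<rparr>)"
    and conn: "Digraph_Component.connected (with_proj H)"
    and meets: "pverts H \<inter> V \<noteq> {}"
  shows "pverts H \<subseteq> V" "parcs H \<subseteq> E"
proof -
  have sub: "pverts H \<subseteq> V \<union> V'" "parcs H \<subseteq> E \<union> E'" and wf: "parcs H \<subseteq> pverts H \<times> pverts H"
    using H by (auto simp: subgraph_with_proj_iff pair_wf_digraph_def)
  show "pverts H \<subseteq> V"
  proof (rule ccontr)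
    assume "\<not> pverts H \<subseteq> V"
    then have "pverts H \<inter> V \<noteq> pverts H" by blast
    moreover have "S \<subseteq> pverts H \<Longrightarrow> S \<noteq> {} \<Longrightarrow> S \<noteq> pverts H \<Longrightarrow>
        \<exists>a\<in>S. \<exists>b\<in>pverts H - S. (a, b) \<in> parcs H \<union> (parcs H)\<inverse>" for S
      using conn by (simp add: connected_with_proj_iff cut_connected_def)
    ultimately obtain a b where "a \<in> pverts H \<inter> V" "b \<in> pverts H - pverts H \<inter> V" "(a, b) \<in> parcs H \<union> (parcs H)\<inverse>"
      using meets Int_lower1 by metis
    then show False using sub E disj by blast
  qed
  then show "parcs H \<subseteq> E" using sub wf E disj by blast
qed

text \<open>A connected subgraph stays inside one part, so the two parts are maximal and nothing
  else is.\<close>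

lemma components_disjoint_union:
  assumes disj: "V \<inter> V' = {}" and conn: "\<lparr>pverts = V, parcs = E\<rparr> \<in> Conn" "\<lparr>pverts = V', parcs = E'\<rparr> \<in> Conn"
  shows "components \<lparr>pverts = V \<union> V', parcs = E \<union> E'\<rparr> = {\<lparr>pverts = V, parcs = E\<rparr>, \<lparr>pverts = V', parcs = E'\<rparr>}"
proof -
  let ?G = "\<lparr>pverts = V, parcs = E\<rparr>" and ?G' = "\<lparr>pverts = V', parcs = E'\<rparr>"
  let ?D = "\<lparr>pverts = V \<union> V', parcs = E \<union> E'\<rparr>"
  have E: "E \<subseteq> V \<times> V" "E' \<subseteq> V' \<times> V'"
    and con: "Digraph_Component.connected (with_proj ?G)" "Digraph_Component.connected (with_proj ?G')"
    using conn unfolding Conn_def by (auto simp: pair_graph_iff)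
  have wf: "pair_wf_digraph ?G" "pair_wf_digraph ?G'" "pair_wf_digraph ?D"
    using E by (auto simp: pair_wf_digraph_def)
  have sub: "subgraph (with_proj ?G) (with_proj ?D)" "subgraph (with_proj ?G') (with_proj ?D)"
    using wf by (auto simp: subgraph_with_proj_iff)
  \<comment> \<open>The union is read in the other order to treat \<open>V'\<close> by the same
    lemma.\<close>
  have swap: "?D = \<lparr>pverts = V' \<union> V, parcs = E' \<union> E\<rparr>" by auto
  note in_V = connected_subgraph_of_disjoint_union[OF disj E]
    and in_V' = connected_subgraph_of_disjoint_union[OF disj[unfolded Int_commute[of V]] E(2,1), folded swap]
  have ne: "V \<noteq> {}" "V' \<noteq> {}" using con by (auto simp: connected_with_proj_iff cut_connected_def)
  have 1: "?G \<in> components ?D"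
    unfolding mem_components_iff
  proof (intro conjI allI impI sub con notI)
    fix H assume H: "H \<noteq> ?G" "subgraph (with_proj ?G) (with_proj H)" "subgraph (with_proj H) (with_proj ?D)"
      "Digraph_Component.connected (with_proj H)"
    then have *: "V \<subseteq> pverts H" "E \<subseteq> parcs H" by (auto simp: subgraph_with_proj_iff)
    with in_V[OF H(3,4)] ne have "pverts H = V" "parcs H = E" by auto
    with H(1) show False by auto
  qed
  have 2: "?G' \<in> components ?D"
    unfolding mem_components_iff
  proof (intro conjI allI impI sub con notI)
    fix H assume H: "H \<noteq> ?G'" "subgraph (with_proj ?G') (with_proj H)" "subgraph (with_proj H) (with_proj ?D)"
      "Digraph_Component.connected (with_proj H)"
    then have *: "V' \<subseteq> pverts H" "E' \<subseteq> parcs H" by (auto simp: subgraph_with_proj_iff)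
    with in_V'[OF H(3,4)] ne have "pverts H = V'" "parcs H = E'" by auto
    with H(1) show False by auto
  qed
  have 3: "H = ?G \<or> H = ?G'" if H: "H \<in> components ?D" for H
  proof -
    have sH: "subgraph (with_proj H) (with_proj ?D)" and cH: "Digraph_Component.connected (with_proj H)"
      and max: "\<And>H'. H' \<noteq> H \<Longrightarrow> subgraph (with_proj H) (with_proj H') \<Longrightarrow> subgraph (with_proj H') (with_proj ?D) \<Longrightarrow>
        \<not> Digraph_Component.connected (with_proj H')"
      using H unfolding mem_components_iff by blast+
    have wfH: "pair_wf_digraph H" and "pverts H \<subseteq> V \<union> V'" using sH by (auto simp: subgraph_with_proj_iff)
    moreover have "pverts H \<noteq> {}" using cH by (simp add: connected_with_proj_iff cut_connected_def)
    ultimately consider "pverts H \<inter> V \<noteq> {}" | "pverts H \<inter> V' \<noteq> {}" by blast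
    then show ?thesis
    proof cases
      case 1
      have "subgraph (with_proj H) (with_proj ?G)"
        using in_V[OF sH cH 1] wf wfH by (simp add: subgraph_with_proj_iff)
      then show ?thesis using max[of ?G] sub con by blast
    next
      case 2
      have "subgraph (with_proj H) (with_proj ?G')"
        using in_V'[OF sH cH 2] wf wfH by (simp add: subgraph_with_proj_iff)
      then show ?thesis using max[of ?G'] sub con by blast
    qed
  qed
  from 1 2 3 show ?thesis by blast
qed

text \<open>A set that splits \<open>V\<close> or \<open>V'\<close> is left by an edge there; any
  other set separates \<open>u\<close> from \<open>v\<close> and is left by the bridge.\<close>

lemma cut_connected_bridge:
  assumes "cut_connected V E" "cut_connected V' E'" "u \<in> V" "v \<in> V'"
  shows "cut_connected (V \<union> V') (bridge E E' u v)"
  unfolding cut_connected_def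
proof (intro conjI allI impI)
  show "V \<union> V' \<noteq> {}" using assms(3) by auto
  fix S assume S: "S \<subseteq> V \<union> V'" "S \<noteq> {}" "S \<noteq> V \<union> V'"
  have inside: "\<exists>a\<in>S. \<exists>b\<in>V \<union> V' - S. (a, b) \<in> bridge E E' u v"
    if "cut_connected W F" "W \<subseteq> V \<union> V'" "F \<subseteq> bridge E E' u v" "S \<inter> W \<noteq> {}" "S \<inter> W \<noteq> W" for W F
  proof -
    have "\<exists>a\<in>S \<inter> W. \<exists>b\<in>W - S \<inter> W. (a, b) \<in> F"
      using that(1,4,5) unfolding cut_connected_def by (meson Int_lower2)
    then show ?thesis using that(2,3) by blast
  qed
  show "\<exists>a\<in>S. \<exists>b\<in>V \<union> V' - S. (a, b) \<in> bridge E E' u v"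
  proof (cases "(S \<inter> V = {} \<or> V \<subseteq> S) \<and> (S \<inter> V' = {} \<or> V' \<subseteq> S)")
    case True
    then have "u \<in> S \<and> v \<notin> S \<or> v \<in> S \<and> u \<notin> S" using S assms(3,4) by blast
    then show ?thesis using assms(3,4) unfolding bridge_def by blast
  next
    case False
    then consider "S \<inter> V \<noteq> {}" "\<not> V \<subseteq> S" | "S \<inter> V' \<noteq> {}" "\<not> V' \<subseteq> S" by blast
    then show ?thesis
    proof cases
      case 1
      show ?thesis by (rule inside[OF assms(1)]) (use 1 in \<open>auto simp: bridge_def\<close>)
    next
      case 2
      show ?thesis by (rule inside[OF assms(2)]) (use 2 in \<open>auto simp: bridge_def\<close>)
    qed
  qed
qed

lemma cut_connected_image:
  assumes "cut_connected V E"
  shows "cut_connected (p ` V) (map_prod p p ` E)"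
  unfolding cut_connected_def
proof (intro conjI allI impI)
  show "p ` V \<noteq> {}" using assms by (simp add: cut_connected_def)
  fix S assume S: "S \<subseteq> p ` V" "S \<noteq> {}" "S \<noteq> p ` V"
  let ?T = "{a \<in> V. p a \<in> S}"
  have "?T \<noteq> {}" "?T \<noteq> V" "?T \<subseteq> V" using S by blast+
  then obtain a b where "a \<in> ?T" "b \<in> V - ?T" "(a, b) \<in> E"
    using assms unfolding cut_connected_def by meson
  then show "\<exists>a\<in>S. \<exists>b\<in>p ` V - S. (a, b) \<in> map_prod p p ` E"
    by (intro bexI[of _ "p a"] bexI[of _ "p b"]) auto
qed

lemma pair_graph_image:
  assumes "pair_graph \<lparr>pverts = V, parcs = E\<rparr>" "inj_on p V"
  shows "pair_graph \<lparr>pverts = p ` V, parcs = map_prod p p ` E\<rparr>"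
proof -
  have E: "finite V" "E \<subseteq> V \<times> V" "sym E" "irrefl E" using assms(1) by (auto simp: pair_graph_iff)
  have "sym (map_prod p p ` E)" using E(3) by (force simp: sym_def)
  moreover have "irrefl (map_prod p p ` E)"
    unfolding irrefl_def
  proof (intro allI notI)
    fix a assume "(a, a) \<in> map_prod p p ` E"
    then obtain c d where "(c, d) \<in> E" "p c = p d" by auto
    moreover from this have "c = d" using assms(2) E(2) by (auto dest: inj_onD)
    ultimately show False using E(4) by (simp add: irrefl_def)
  qed
  ultimately show ?thesis using E map_prod_image_subset[OF E(2)] by (simp add: pair_graph_iff)
qed

lemma digraph_iso_image:
  assumes "pair_graph \<lparr>pverts = V, parcs = E\<rparr>" "inj_on p V"
  shows "digraph_iso (with_proj \<lparr>pverts = V, parcs = E\<rparr>) (with_proj \<lparr>pverts = p ` V, parcs = map_prod p p ` E\<rparr>)"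
  unfolding digraph_iso_def
proof (intro exI conjI)
  let ?G = "\<lparr>pverts = V, parcs = E\<rparr>"
  let ?f = "\<lparr>iso_verts = p, iso_arcs = map_prod p p, iso_head = snd, iso_tail = fst\<rparr>"
  interpret pair_graph ?G by (rule assms(1))
  have "E \<subseteq> V \<times> V" using assms(1) by (simp add: pair_graph_iff)
  then have "inj_on (map_prod p p) E" by (rule inj_on_subset[OF map_prod_inj_on[OF assms(2,2)]])
  then show "pre_digraph.digraph_isomorphism (with_proj ?G) ?f"
    unfolding pre_digraph.digraph_isomorphism_def using assms(2) wf_digraph by auto
  show "with_proj \<lparr>pverts = p ` V, parcs = map_prod p p ` E\<rparr> = app_iso ?f (with_proj ?G)"
    by (simp add: app_iso_def with_proj_def)
qed

text \<open>The disjoint union of two connected members is in \<open>C\<close> by decomposability,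
  as its components are these two; bridge-addability then admits the edge.\<close>

lemma bridge_class_Conn:
  assumes "graph_class C" "addable C"
  shows "bridge_class (\<lambda>V E. \<lparr>pverts = V, parcs = E\<rparr> \<in> C \<inter> Conn)"
proof
  fix V V' :: "nat set" and E E' :: "nat rel"
  assume VE: "\<lparr>pverts = V, parcs = E\<rparr> \<in> C \<inter> Conn"
  then have G: "pair_graph \<lparr>pverts = V, parcs = E\<rparr>" and cut: "cut_connected V E" by (auto simp: in_Conn_iff)
  show "finite V" "E \<subseteq> V \<times> V" "sym E" using G by (auto simp: pair_graph_iff)
  show "cut_connected V E" by (rule cut)
  {
    fix p :: "nat \<Rightarrow> nat" assume p: "inj_on p V"
    have "\<lparr>pverts = p ` V, parcs = map_prod p p ` E\<rparr> \<in> C"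
      using assms(1) VE pair_graph_image[OF G p] digraph_iso_image[OF G p] unfolding graph_class_def by blast
    moreover have "\<lparr>pverts = p ` V, parcs = map_prod p p ` E\<rparr> \<in> Conn"
      using pair_graph_image[OF G p] cut_connected_image[OF cut] by (simp add: in_Conn_iff)
    ultimately show "\<lparr>pverts = p ` V, parcs = map_prod p p ` E\<rparr> \<in> C \<inter> Conn" by simp
  }
  fix u v assume VE': "\<lparr>pverts = V', parcs = E'\<rparr> \<in> C \<inter> Conn" and disj: "V \<inter> V' = {}" and uv: "u \<in> V" "v \<in> V'"
  have G': "pair_graph \<lparr>pverts = V', parcs = E'\<rparr>" and cut': "cut_connected V' E'" using VE' by (auto simp: in_Conn_iff)
  let ?G = "\<lparr>pverts = V, parcs = E\<rparr>" and ?G' = "\<lparr>pverts = V', parcs = E'\<rparr>"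
  let ?D = "\<lparr>pverts = V \<union> V', parcs = E \<union> E'\<rparr>"
  have "pair_graph ?D"
    using G G' by (auto simp: pair_graph_iff sym_Un irrefl_def)
  moreover have comp: "components ?D = {?G, ?G'}"
    by (rule components_disjoint_union) (use VE VE' disj in auto)
  ultimately have "?D \<in> C" using assms(2) VE VE' unfolding addable_def decomposable_def by auto
  moreover have "?G \<noteq> ?G'" using disj uv by auto
  ultimately have add: "add_edge ?D u v \<in> C"
    using assms(2) comp uv unfolding addable_def bridge_addable_def by fastforce
  have eq: "add_edge ?D u v = \<lparr>pverts = V \<union> V', parcs = bridge E E' u v\<rparr>"
    by (simp add: add_edge_def bridge_def)
  have "pair_graph (add_edge ?D u v)" using assms(1) add by (simp add: graph_class_def)
  then have "\<lparr>pverts = V \<union> V', parcs = bridge E E' u v\<rparr> \<in> Conn"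
    using cut_connected_bridge[OF cut cut' uv] unfolding eq by (simp add: in_Conn_iff)
  with add show "\<lparr>pverts = V \<union> V', parcs = bridge E E' u v\<rparr> \<in> C \<inter> Conn"
    unfolding eq by simp
qed

section \<open>The zero-one law for the connected members of an addable class\<close>

theorem theorem17:
  fixes C :: "ngraph set" and \<phi> :: mso
  assumes "graph_class C" and "small C" and "addable C" and "mso_sentence \<phi>"
  defines "p \<equiv> (\<lambda>n. measure_pmf.prob (random_graph (C \<inter> Conn) n) {G. models G \<phi>})"
  shows "(p \<longlongrightarrow> 0) (sizes_at_top (C \<inter> Conn)) \<or> (p \<longlongrightarrow> 1) (sizes_at_top (C \<inter> Conn))"
proof -
  let ?g = "\<lambda>n E. \<lparr>pverts = {1..n :: nat}, parcs = E\<rparr>"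
  interpret bridge_class "\<lambda>V E. \<lparr>pverts = V, parcs = E\<rparr> \<in> C \<inter> Conn"
    by (rule bridge_class_Conn[OF assms(1,3)])
  have inj: "inj_on (?g n) A" for n A by (auto intro: inj_onI)
  have labelled_eq: "labelled (C \<inter> Conn) n = ?g n ` Kn n" for n
  proof (intro equalityI subsetI)
    fix G assume G: "G \<in> labelled (C \<inter> Conn) n"
    then have "G = ?g n (parcs G)" by (simp add: labelled_def)
    with G show "G \<in> ?g n ` Kn n" unfolding Kn_def labelled_def by (metis (mono_tags, lifting) imageI mem_Collect_eq)
  next
    fix G assume "G \<in> ?g n ` Kn n"
    then show "G \<in> labelled (C \<inter> Conn) n" unfolding Kn_def by (auto simp: labelled_def)
  qed
  obtain d :: real where d: "\<And>n. real (card (labelled C n)) \<le> d ^ n * fact n"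
    using assms(2) unfolding small_def by auto
  \<comment> \<open>\<open>d\<close> may be negative or zero; \<open>\<bar>d\<bar> + 1\<close> is a
    positive constant for the same bound.\<close>
  have "real (card (Kn n)) \<le> (\<bar>d\<bar> + 1) ^ n * fact n" for n
  proof -
    have "card (Kn n) = card (labelled (C \<inter> Conn) n)" unfolding labelled_eq by (rule card_image[OF inj, symmetric])
    also have "\<dots> \<le> card (labelled C n)"
      by (rule card_mono[OF finite_labelled[OF assms(1)]]) (auto simp: labelled_def)
    finally have "real (card (Kn n)) \<le> d ^ n * fact n" using d[of n] by linarith
    also have "d ^ n \<le> \<bar>d ^ n\<bar>" by simp
    also have "\<dots> \<le> (\<bar>d\<bar> + 1) ^ n" unfolding power_abs by (rule power_mono) auto
    finally show ?thesis by (simp add: mult_right_mono)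
  qed
  then obtain \<beta> where \<beta>: "\<And>\<epsilon> :: real. 0 < \<epsilon> \<Longrightarrow> eventually (\<lambda>n.
      real (card {E \<in> Kn n. models (?g n E) \<phi> \<noteq> \<beta>}) \<le> \<epsilon> * card (Kn n)) sequentially"
    by (rule zero_one[OF _ _ assms(4)]) auto
  define l :: real where "l = (if \<beta> then 1 else 0)"
  \<comment> \<open>The distance from the limit is the proportion of members whose truth value is
    not \<open>\<beta>\<close>.\<close>
  have dist: "\<bar>p n - l\<bar> = card {E \<in> Kn n. models (?g n E) \<phi> \<noteq> \<beta>} / card (Kn n)" and pos: "0 < card (Kn n)"
    if ne: "labelled (C \<inter> Conn) n \<noteq> {}" for n
  proof -
    show pos: "0 < card (Kn n)" using ne finite_Kn[of n] by (auto simp: labelled_eq card_gt_0_iff)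
    let ?T = "{E \<in> Kn n. models (?g n E) \<phi>}" and ?F = "{E \<in> Kn n. \<not> models (?g n E) \<phi>}"
    have "p n = card (?g n ` Kn n \<inter> {G. models G \<phi>}) / card (?g n ` Kn n)"
      unfolding p_def random_graph_def labelled_eq
      by (rule measure_pmf_of_set) (use ne finite_Kn[of n] in \<open>auto simp: labelled_eq\<close>)
    also have "?g n ` Kn n \<inter> {G. models G \<phi>} = ?g n ` ?T" by auto
    finally have p: "p n = card ?T / card (Kn n)" by (simp only: card_image[OF inj])
    have "card (Kn n) = card (?T \<union> ?F)" by (rule arg_cong[where f = card]) auto
    also have "\<dots> = card ?T + card ?F" by (rule card_Un_disjoint) (use finite_Kn[of n] in auto)
    finally have sum: "card (Kn n) = card ?T + card ?F" .
    have "1 - real t / real m = real f / real m" if "m = t + f" "0 < m" for m t f :: nat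
    proof -
      have "real f = real m - real t" using that by simp
      moreover have "real m / real m = 1" using that(2) by simp
      ultimately show ?thesis by (simp only: diff_divide_distrib)
    qed
    from this[OF sum pos] have q: "\<bar>p n - 1\<bar> = card ?F / card (Kn n)"
      unfolding p by (simp only: abs_minus_commute[of _ 1] abs_divide abs_of_nat)
    show "\<bar>p n - l\<bar> = card {E \<in> Kn n. models (?g n E) \<phi> \<noteq> \<beta>} / card (Kn n)"
    proof (cases \<beta>)
      case True
      then show ?thesis using q unfolding l_def by (simp only: if_True simp_thms)
    next
      case False
      have "\<bar>p n\<bar> = card ?T / card (Kn n)" unfolding p by (simp only: abs_divide abs_of_nat)
      then show ?thesis using False unfolding l_def by (simp only: if_False simp_thms diff_0_right not_not)
    qed
  qed
  have "(p \<longlongrightarrow> l) (sizes_at_top (C \<inter> Conn))"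
  proof (rule tendstoI)
    fix e :: real assume "0 < e"
    \<comment> \<open>Half of \<open>e\<close> turns the weak bound into a strict one.\<close>
    then have "0 < e / 2" by simp
    from \<beta>[OF this] have "eventually (\<lambda>n. n \<in> {n. labelled (C \<inter> Conn) n \<noteq> {}} \<longrightarrow> dist (p n) l < e) sequentially"
    proof eventually_elim
      case (elim n)
      show ?case
      proof
        assume "n \<in> {n. labelled (C \<inter> Conn) n \<noteq> {}}"
        then have ne: "labelled (C \<inter> Conn) n \<noteq> {}" by blast
        have "\<bar>p n - l\<bar> \<le> e / 2"
          unfolding dist[OF ne] using elim pos[OF ne] by (simp add: divide_le_eq)
        then show "dist (p n) l < e" using \<open>0 < e\<close> by (simp add: dist_real_def)
      qed
    qed
    then show "eventually (\<lambda>n. dist (p n) l < e) (sizes_at_top (C \<inter> Conn))"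
      unfolding sizes_at_top_def eventually_inf_principal .
  qed
  then show ?thesis unfolding l_def by (cases \<beta>) auto
qed

end
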